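(* Let $\{\nu^{(1/2)}_t\}_{t\ge0}$ be the free-convolution semigroup (free $1/2$-stable semigroup) given by $\nu^{(1/2)}_0=\delta_0$ and $$\nu^{(1/2)}_t(dx)=\frac{t\sqrt{4x-t^2}}{2\pi x^2}1_{(t^2/4,\infty)}(x)\,dx,\qquad t>0.$$ The Biane process associated to $\{\nu^{(1/2)}_t\}_{t\ge0}$ is the process $\mathbb{Z}^{(1/2)}$, i.e. (as an equality in law of Markov processes) the Markov process starting from $0$ at time $0$ with transition probability density $$f^{(1/2)}_{t_1,t_2}(y_1,y_2)=\frac{(t_2-t_1)\sqrt{4y_2-t_2^2}}{2\pi\left[(y_2-y_1)^2-(t_2-t_1)(t_1y_2-t_2y_1)\right]},\quad 0\le t_1<t_2<\infty,\ y_1>\frac{t_1^2}{4},\ y_2>\frac{t_2^2}{4}.$$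
   Context: Let $\mathbb{C}^+=\{z\in\mathbb{C}:\Im z>0\}$ and $\mathbb{C}^-=\{z\in\mathbb{C}:\Im z<0\}$. For a probability measure $\nu$ on $\mathbb{R}$, $G_\nu(z)=\int\frac{\nu(dx)}{z-x}$ is its Cauchy--Stieltjes transform, and its $R$-transform is $R_\nu(z)=G_\nu^{-1}(z)-1/z$, where $G_\nu^{-1}$ is the right inverse of $G_\nu$ on a suitable domain. The free convolution $\mu\boxplus\nu$ is the unique probability measure with $R$-transform $R_\mu+R_\nu$ on the common domain. A free-convolution semigroup is a family $\{\nu_t\}_{t\ge0}$ of probability measures with $\nu_{t+s}=\nu_t\boxplus\nu_s$ and $\nu_0=\delta_0$. Biane process associated to a free-convolution semigroup $\{\nu_t\}_{t\ge0}$: for $s<t$ there is a unique analytic function $F=F_{s,t}$ on $\mathbb{C}\setminus\mathbb{R}$ such that $$\int\frac{\nu_t(dx)}{z-x}=\int\frac{\nu_s(dx)}{F(z)-x}\quad\text{for }z\in\mathbb{C}^+$$ and $$F(\bar z)=\overline{F(z)},\quad F(\mathbb{C}^+)\subset\mathbb{C}^+,\quad \Im F(z)\ge\Im z\ \ (z\in\mathbb{C}^+),\quad \lim_{y\to\infty}\frac{F(iy)}{iy}=1.$$ For each $x\in\mathbb{R}$, the map $\mathbb{C}^+\ni z\mapsto 1/(F(z)-x)\in\mathbb{C}^-$ is the Cauchy--Stieltjes transform of a unique probability measure $Q_{s,t}(x,dy)$, that is, $$\int\frac{1}{z-y}Q_{s,t}(x,dy)=\frac{1}{F(z)-x}.$$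 The measures $Q_{s,t}(x,dy)$ satisfy the Chapman--Kolmogorov equations, are Feller, and $Q_{0,t}(0,dy)=\nu_t(dy)$ (these are known results of Biane). The Biane process associated to $\{\nu_t\}_{t\ge0}$ is the Markov process $\{\mathbb{Z}_t\}_{t\ge0}$ starting from $0$ with transition probabilities $Q_{s,t}(x,dy)$; its marginal law at time $t$ is $\nu_t$. The process $\mathbb{Z}^{(1/2)}$ has support $[t^2/4,\infty)$ at time $t$, and its law at time $t>0$ is obtained from $f^{(1/2)}_{t_1,t_2}(y_1,y_2)$ with $t_1=0$, $y_1=0$, $t_2=t$. *)

theory Defs
  imports "HOL-Probability.Probability" "HOL-Complex_Analysis.Complex_Analysis"
begin

definition cauchy_transform :: "real measure \<Rightarrow> complex \<Rightarrow> complex" where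
  "cauchy_transform \<nu> z = (LINT x|\<nu>. 1 / (z - complex_of_real x))"

definition real_prob :: "real measure \<Rightarrow> bool" where
  "real_prob \<nu> \<longleftrightarrow> prob_space \<nu> \<and> sets \<nu> = sets borel"


subsection \<open>Free convolution\<close>

text \<open>The domains of \<open>R\<close>-transforms: reciprocals of the truncated cones
  \<open>Im z > \<beta>, |Re z| < \<alpha> Im z\<close> of Bercovici and Voiculescu.  They lie in the lower half plane
  and have \<open>0\<close> as a boundary point.\<close>

definition R_domain :: "real \<Rightarrow> real \<Rightarrow> complex set" where
  "R_domain \<alpha> \<beta> = {w. Im (1 / w) > \<beta> \<and> \<bar>Re (1 / w)\<bar> < \<alpha> * Im (1 / w)}"

text \<open>A right inverse of the Cauchy transform need not be unique (for the law
  \<open>(\<delta>\<^sub>-\<^sub>1 + \<delta>\<^sub>1) / 2\<close> there is a second one, behaving like \<open>- w\<close>); the one that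
  defines the \<open>R\<close>-transform is singled out by \<open>K w \<sim> 1 / w\<close> as \<open>w \<rightarrow> 0\<close>.\<close>

definition is_cauchy_inverse :: "real measure \<Rightarrow> complex set \<Rightarrow> (complex \<Rightarrow> complex) \<Rightarrow> bool" where
  "is_cauchy_inverse \<nu> D K \<longleftrightarrow>
     K holomorphic_on D \<and>
     (\<forall>w\<in>D. Im (K w) > 0 \<and> cauchy_transform \<nu> (K w) = w) \<and>
     ((\<lambda>w. w * K w) \<longlongrightarrow> 1) (at 0 within D)"

definition is_R_transform :: "real measure \<Rightarrow> complex set \<Rightarrow> (complex \<Rightarrow> complex) \<Rightarrow> bool" where
  "is_R_transform \<nu> D R \<longleftrightarrow>
     (\<exists>K. is_cauchy_inverse \<nu> D K \<and> (\<forall>w\<in>D. R w = K w - 1 / w))"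

text \<open>\<open>\<rho> = \<mu> \<boxplus> \<nu>\<close>\<close>

definition is_free_convolution :: "real measure \<Rightarrow> real measure \<Rightarrow> real measure \<Rightarrow> bool" where
  "is_free_convolution \<mu> \<nu> \<rho> \<longleftrightarrow>
     real_prob \<mu> \<and> real_prob \<nu> \<and> real_prob \<rho> \<and>
     (\<exists>\<alpha>>0. \<exists>\<beta>>0. \<exists>R S.
        is_R_transform \<mu> (R_domain \<alpha> \<beta>) R \<and>
        is_R_transform \<nu> (R_domain \<alpha> \<beta>) S \<and>
        is_R_transform \<rho> (R_domain \<alpha> \<beta>) (\<lambda>w. R w + S w))"

text \<open>Families indexed by time \<open>t \<ge> 0\<close> are functions on all of \<open>real\<close> whose values at negative
  times are never used.\<close>

definition free_convolution_semigroup :: "(real \<Rightarrow> real measure) \<Rightarrow> bool" where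
  "free_convolution_semigroup \<nu> \<longleftrightarrow>
     (\<forall>t\<ge>0. real_prob (\<nu> t)) \<and> \<nu> 0 = return borel 0 \<and>
     (\<forall>s\<ge>0. \<forall>t\<ge>0. is_free_convolution (\<nu> t) (\<nu> s) (\<nu> (t + s)))"


subsection \<open>Markov processes\<close>

definition natural_filtration :: "'a measure \<Rightarrow> (real \<Rightarrow> 'a \<Rightarrow> real) \<Rightarrow> real \<Rightarrow> 'a measure" where
  "natural_filtration M Z s =
     sigma (space M) {Z r -` B \<inter> space M | r B. 0 \<le> r \<and> r \<le> s \<and> B \<in> sets borel}"

text \<open>The process \<open>(Z t)\<close>, \<open>t \<ge> 0\<close>, starts at \<open>x0\<close>, has state space \<open>E t\<close> at time \<open>t\<close>, and
  is Markov with transition probabilities \<open>P s t x (dy)\<close>.  Only the values \<open>P s t x\<close> with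
  \<open>x \<in> E s\<close> matter.\<close>

definition markov_process ::
  "'a measure \<Rightarrow> (real \<Rightarrow> 'a \<Rightarrow> real) \<Rightarrow> real \<Rightarrow> (real \<Rightarrow> real set) \<Rightarrow>
   (real \<Rightarrow> real \<Rightarrow> real \<Rightarrow> real measure) \<Rightarrow> bool" where
  "markov_process M Z x0 E P \<longleftrightarrow>
     prob_space M \<and>
     (\<forall>t\<ge>0. Z t \<in> borel_measurable M) \<and>
     (AE \<omega> in M. Z 0 \<omega> = x0) \<and>
     (\<forall>t\<ge>0. AE \<omega> in M. Z t \<omega> \<in> E t) \<and>
     (\<forall>s\<ge>0. \<forall>t>s. \<forall>B\<in>sets borel. AE \<omega> in M.
        real_cond_exp M (natural_filtration M Z s) (indicator (Z t -` B \<inter> space M)) \<omega> =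
        measure (P s t (Z s \<omega>)) B)"

text \<open>The law on path space, with the product \<open>\<sigma>\<close>-algebra.\<close>

definition process_law :: "'a measure \<Rightarrow> (real \<Rightarrow> 'a \<Rightarrow> real) \<Rightarrow> (real \<Rightarrow> real) measure" where
  "process_law M Z = distr M (PiM {0..} (\<lambda>_. borel)) (\<lambda>\<omega>. \<lambda>t\<in>{0..}. Z t \<omega>)"


subsection \<open>Biane processes\<close>

definition biane_subordinator ::
  "(real \<Rightarrow> real measure) \<Rightarrow> real \<Rightarrow> real \<Rightarrow> (complex \<Rightarrow> complex) \<Rightarrow> bool" where
  "biane_subordinator \<nu> s t F \<longleftrightarrow>
     F holomorphic_on (- \<real>) \<and>
     (\<forall>z. Im z > 0 \<longrightarrow> cauchy_transform (\<nu> t) z = cauchy_transform (\<nu> s) (F z)) \<and>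
     (\<forall>z. z \<notin> \<real> \<longrightarrow> F (cnj z) = cnj (F z)) \<and>
     (\<forall>z. Im z > 0 \<longrightarrow> Im (F z) > 0 \<and> Im (F z) \<ge> Im z) \<and>
     ((\<lambda>y. F (\<i> * complex_of_real y) / (\<i> * complex_of_real y)) \<longlongrightarrow> 1) at_top"

definition biane_kernel ::
  "(real \<Rightarrow> real measure) \<Rightarrow> real \<Rightarrow> real \<Rightarrow> (real \<Rightarrow> real measure) \<Rightarrow> bool" where
  "biane_kernel \<nu> s t Q \<longleftrightarrow>
     (\<exists>F. biane_subordinator \<nu> s t F \<and>
        (\<forall>x. real_prob (Q x) \<and>
           (\<forall>z. Im z > 0 \<longrightarrow> cauchy_transform (Q x) z = 1 / (F z - complex_of_real x))))"

definition biane_process ::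
  "(real \<Rightarrow> real measure) \<Rightarrow> 'a measure \<Rightarrow> (real \<Rightarrow> 'a \<Rightarrow> real) \<Rightarrow> bool" where
  "biane_process \<nu> M Z \<longleftrightarrow>
     free_convolution_semigroup \<nu> \<and>
     (\<exists>Q. (\<forall>s\<ge>0. \<forall>t>s. biane_kernel \<nu> s t (Q s t)) \<and>
          markov_process M Z 0 (\<lambda>_. UNIV) Q)"


subsection \<open>The free \<open>1/2\<close>-stable semigroup and the process \<open>Z\<close> with index \<open>1/2\<close>\<close>

definition nu_half :: "real \<Rightarrow> real measure" where
  "nu_half t =
     (if t = 0 then return borel 0
      else density lborel (\<lambda>x. ennreal
        (t * sqrt (4 * x - t\<^sup>2) / (2 * pi * x\<^sup>2) * indicator {t\<^sup>2 / 4<..} x)))"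

definition f_half :: "real \<Rightarrow> real \<Rightarrow> real \<Rightarrow> real \<Rightarrow> real" where
  "f_half t1 t2 y1 y2 =
     (t2 - t1) * sqrt (4 * y2 - t2\<^sup>2) /
     (2 * pi * ((y2 - y1)\<^sup>2 - (t2 - t1) * (t1 * y2 - t2 * y1)))"

text \<open>The starting points \<open>y1 > t\<^sup>2 / 4\<close> for which \<open>f_half t _ y1 _\<close> is a transition density,
  together with the initial position \<open>y1 = 0\<close> at \<open>t = 0\<close>.\<close>

definition states_half :: "real \<Rightarrow> real set" where
  "states_half t = {y. y > t\<^sup>2 / 4 \<or> (t = 0 \<and> y = 0)}"

definition P_half :: "real \<Rightarrow> real \<Rightarrow> real \<Rightarrow> real measure" where
  "P_half t1 t2 y1 =
     density lborel (\<lambda>y2. ennreal (f_half t1 t2 y1 y2 * indicator {t2\<^sup>2 / 4<..} y2))"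

definition Z_half_process :: "'a measure \<Rightarrow> (real \<Rightarrow> 'a \<Rightarrow> real) \<Rightarrow> bool" where
  "Z_half_process M Z \<longleftrightarrow> markov_process M Z 0 states_half P_half"

end

theory Submission
  imports Defs "HOL-Real_Asymp.Real_Asymp"
begin

text \<open>
  Everything becomes explicit in the variable \<open>r = csqrt (t\<^sup>2 - 4 z)\<close>, which has positive real part
  when \<open>Im z > 0\<close>.  The Cauchy transform of the law at time \<open>t\<close> is \<open>- 4 / (t + r)\<^sup>2\<close>.  Solving for \<open>z\<close>
  gives the inverse \<open>1 / w + t csqrt (- 1 / w)\<close>, so the \<open>R\<close>-transform is linear in \<open>t\<close> and the laws
  form a free convolution semigroup.  The subordination equation
  \<open>t + csqrt (t\<^sup>2 - 4 z) = s + csqrt (s\<^sup>2 - 4 F)\<close> can be solved for \<open>F\<close>, since a number with positive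
  real part is determined by its square; and \<open>1 / (F - x)\<close> turns out to be
  \<open>- 4 / (r\<^sup>2 + \<sigma> r + m)\<close> with \<open>\<sigma> = 2 (t - s)\<close> and \<open>m = (t - s)\<^sup>2 - s\<^sup>2 + 4 x\<close>.

  The analytic core is therefore one family of measures on \<open>(t\<^sup>2 / 4, \<infinity>)\<close>, indexed by \<open>\<sigma> > 0\<close> and
  \<open>m \<ge> 0\<close>, whose Cauchy transform is \<open>- 4 / (r\<^sup>2 + \<sigma> r + m)\<close>
  (\<open>cauchy_transform_half_measure\<close>).  It contains the laws of the semigroup and the transition
  densities \<open>f_half\<close> from all points of the state space.  In the variable \<open>S = sqrt (4 y - t\<^sup>2)\<close> the
  transform is a rational integral, computed by partial fractions from
  \<open>\<integral> dS / (S\<^sup>2 + p\<^sup>2)\<close>; coinciding poles are reached by dominated convergence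
  (\<open>quartic_kernel_transform\<close>).  A Biane kernel is also required at points outside
  the state space.  There \<open>m\<close> can be negative, and the measure has an additional atom
  (\<open>exists_half_measure\<close>).  Kernels are identified with their transforms by injectivity of the Cauchy
  transform, obtained from \<open>Levy_uniqueness\<close> by smoothing with the Poisson kernel
  (\<open>cauchy_transform_unique\<close>).

  The statements about processes then follow from the one-dimensional laws.  A Biane process starts
  at \<open>0\<close> and has law \<open>nu_half t\<close> at time \<open>t\<close>; it stays almost surely in the state space at each
  time, where its kernel is \<open>P_half\<close>.  Finally, a Markov process with measurable kernels
  has its finite-dimensional distributions, and so its law, determined by starting point and kernels
  (\<open>markov_process_law_unique\<close>).
\<close>

section \<open>Integrals of square-root kernels\<close>

lemma einterval_Ioi: "einterval (ereal a) \<infinity> = {a<..}"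
  by (auto simp: einterval_def)

lemma has_real_derivative_sqrt_edge: 
  assumes "y > t\<^sup>2 / 4"
  shows "((\<lambda>y. sqrt (4 * y - t\<^sup>2)) has_real_derivative 2 / sqrt (4 * y - t\<^sup>2)) (at y)"
  using assms by (auto intro!: derivative_eq_intros simp: field_simps)

lemma integrable_real_sqrt_kernel:
  "set_integrable lborel {t\<^sup>2 / 4<..} (\<lambda>y. 1 / (sqrt (4 * y - t\<^sup>2) * (1 + (sqrt (4 * y - t\<^sup>2))\<^sup>2)))"
proof -
  let ?S = "\<lambda>y. sqrt (4 * y - t\<^sup>2)"
  have "set_integrable lborel (einterval (ereal (t\<^sup>2 / 4)) \<infinity>) (\<lambda>y. 1 / (?S y * (1 + (?S y)\<^sup>2)))"
  proof (rule interval_integral_FTC_nonneg(1)[where F = "\<lambda>y. arctan (?S y) / 2" and A = 0 and B = "pi / 4"])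
    fix x assume "ereal (t\<^sup>2 / 4) < ereal x" "ereal x < \<infinity>"
    then have x: "x > t\<^sup>2 / 4" by simp
    then have pos: "?S x > 0" by simp
    show "((\<lambda>y. arctan (?S y) / 2) has_real_derivative 1 / (?S x * (1 + (?S x)\<^sup>2))) (at x)"
      by (rule DERIV_cong[OF DERIV_cdivide[OF DERIV_chain2[OF DERIV_arctan has_real_derivative_sqrt_edge[OF x]]]])
         (use pos in \<open>simp add: divide_simps\<close>)
    show "isCont (\<lambda>y. 1 / (?S y * (1 + (?S y)\<^sup>2))) x"
      using pos by (intro continuous_intros) (auto simp: add_nonneg_eq_0_iff)
  next
    have "((\<lambda>y. arctan (?S y) / 2) \<longlongrightarrow> arctan (?S (t\<^sup>2 / 4)) / 2) (at_right (t\<^sup>2 / 4))"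
      by (intro tendsto_intros) simp
    then show "(((\<lambda>y. arctan (?S y) / 2) \<circ> real_of_ereal) \<longlongrightarrow> 0) (at_right (ereal (t\<^sup>2 / 4)))"
      by (simp add: ereal_tendsto_simps)
  next
    have "filterlim ?S at_top at_top" by real_asymp
    then have "((\<lambda>y. arctan (?S y) / 2) \<longlongrightarrow> (pi / 2) / 2) at_top"
      by (intro tendsto_intros filterlim_compose[OF tendsto_arctan_at_top]) auto
    then show "(((\<lambda>y. arctan (?S y) / 2) \<circ> real_of_ereal) \<longlongrightarrow> pi / 4) (at_left \<infinity>)"
      by (simp add: ereal_tendsto_simps)
  qed (auto)
  then show ?thesis by (simp add: einterval_Ioi)
qed

text \<open>The factorization \<open>s\<^sup>2 + p\<^sup>2 = (p + i s) (p - i s)\<close> bounds the quadratic from below: both factors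
  have real part \<open>Re p > 0\<close>, so each has norm at least a constant times \<open>1 + s\<close>.\<close>

lemma norm_quadratic_ge:
  fixes p :: complex
  assumes "Re p > 0"
  shows "\<exists>C>0. \<forall>s\<ge>0. 1 + s\<^sup>2 \<le> C * norm (complex_of_real s ^ 2 + p\<^sup>2)"
proof -
  \<comment> \<open>For \<open>w\<close> on the line \<open>Re w = Re p\<close>: \<open>1 \<le> norm w / Re p\<close> and \<open>s \<le> norm w + \<bar>Im p\<bar> norm w / Re p\<close>.\<close>
  define K where "K = 1 / Re p + (\<bar>Im p\<bar> / Re p + 1)"
  have K: "K > 0" using assms by (simp add: K_def add_pos_nonneg)
  have lin: "1 + s \<le> K * norm (w)" if "Re w = Re p" "s \<le> \<bar>Im w\<bar> + \<bar>Im p\<bar>" for w s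
  proof -
    have n1: "norm w / Re p \<ge> 1" using complex_Re_le_cmod[of w] that assms by simp
    have "K * norm w = norm w / Re p + \<bar>Im p\<bar> * (norm w / Re p) + norm w"
      by (simp add: K_def algebra_simps)
    moreover have "\<bar>Im p\<bar> * (norm w / Re p) \<ge> \<bar>Im p\<bar> * 1"
      using n1 by (intro mult_left_mono) auto
    ultimately show ?thesis using abs_Im_le_cmod[of w] that n1 by linarith
  qed
  have "1 + s\<^sup>2 \<le> K\<^sup>2 * norm (complex_of_real s ^ 2 + p\<^sup>2)" if "s \<ge> 0" for s
  proof -
    have eq: "complex_of_real s ^ 2 + p\<^sup>2 = (p + \<i> * s) * (p - \<i> * s)"
      by (simp add: algebra_simps power2_eq_square)
    have "1 + s\<^sup>2 \<le> (1 + s) * (1 + s)" using that by (simp add: power2_eq_square algebra_simps)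
    also have "\<dots> \<le> (K * norm (p + \<i> * s)) * (K * norm (p - \<i> * s))"
      using that K by (intro mult_mono lin mult_nonneg_nonneg) auto
    finally show ?thesis unfolding eq norm_mult by (simp add: power2_eq_square mult_ac)
  qed
  then show ?thesis using K by (intro exI[of _ "K\<^sup>2"]) auto
qed

lemma norm_quadratic_nonzero:
  fixes p :: complex
  assumes "Re p > 0"
  shows "complex_of_real s ^ 2 + p\<^sup>2 \<noteq> 0"
proof -
  have eq: "complex_of_real s ^ 2 + p\<^sup>2 = (p + \<i> * s) * (p - \<i> * s)"
    by (simp add: algebra_simps power2_eq_square)
  have "p + \<i> * s \<noteq> 0" "p - \<i> * s \<noteq> 0" using assms by (auto simp: complex_eq_iff)
  then show ?thesis by (simp add: eq)
qed

lemma integrable_sqrt_kernel: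
  fixes p :: complex
  assumes "Re p > 0"
  shows "set_integrable lborel {t\<^sup>2 / 4<..}
    (\<lambda>y. 1 / (complex_of_real (sqrt (4 * y - t\<^sup>2)) * (complex_of_real (sqrt (4 * y - t\<^sup>2)) ^ 2 + p\<^sup>2)))"
proof -
  let ?S = "\<lambda>y. sqrt (4 * y - t\<^sup>2)"
  obtain C where C: "C > 0" "\<And>s. s \<ge> 0 \<Longrightarrow> 1 + s\<^sup>2 \<le> C * norm (complex_of_real s ^ 2 + p\<^sup>2)"
    using norm_quadratic_ge[OF assms] by blast
  have int: "integrable lborel (\<lambda>y. C * (indicator {t\<^sup>2 / 4<..} y *\<^sub>R (1 / (?S y * (1 + (?S y)\<^sup>2)))))"
    using integrable_real_sqrt_kernel[of t] by (intro integrable_mult_right) (simp add: set_integrable_def)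
  show ?thesis unfolding set_integrable_def
  proof (rule Bochner_Integration.integrable_bound[OF int])
    show "AE x in lborel. norm (indicat_real {t\<^sup>2 / 4<..} x *\<^sub>R (1 / (complex_of_real (?S x) * ((complex_of_real (?S x))\<^sup>2 + p\<^sup>2))))
        \<le> norm (C * indicat_real {t\<^sup>2 / 4<..} x *\<^sub>R (1 / (?S x * (1 + (?S x)\<^sup>2))))"
    proof (rule AE_I2)
      fix x
      show "norm (indicat_real {t\<^sup>2 / 4<..} x *\<^sub>R (1 / (complex_of_real (?S x) * ((complex_of_real (?S x))\<^sup>2 + p\<^sup>2))))
        \<le> norm (C * indicat_real {t\<^sup>2 / 4<..} x *\<^sub>R (1 / (?S x * (1 + (?S x)\<^sup>2))))"
      proof (cases "x > t\<^sup>2 / 4")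
        case True
        define s where "s = ?S x"
        have s: "s > 0" using True by (simp add: s_def)
        define n where "n = norm (complex_of_real s ^ 2 + p\<^sup>2)"
        have n: "n > 0" using norm_quadratic_nonzero[OF assms, of s] by (simp add: n_def)
        have "1 / (s * n) \<le> C / (s * (1 + s\<^sup>2))"
          using C(2)[of s] s n C(1) unfolding n_def[symmetric]
          by (simp add: divide_simps add_pos_nonneg)
        then have "1 / (s * n) \<le> \<bar>C\<bar> / (\<bar>s\<bar> * \<bar>1 + s\<^sup>2\<bar>)" using C(1) s by simp
        moreover have "norm (1 / (complex_of_real s * ((complex_of_real s)\<^sup>2 + p\<^sup>2))) = 1 / (s * n)"
          using s by (simp add: n_def norm_divide norm_mult)
        ultimately show ?thesis using True s unfolding s_def[symmetric]
          by (simp add: abs_mult)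
      qed auto
    qed
  qed (measurable)
qed

text \<open>With \<open>S = sqrt (4 y - t\<^sup>2)\<close> one has \<open>dy / S = dS / 2\<close>, so the integral is half of
  \<open>\<integral> dS / (S\<^sup>2 + p\<^sup>2)\<close> over the positive half line.  For complex \<open>p\<close> the primitive
  \<open>(Ln (p + i S) - Ln (p - i S)) / (2 i p)\<close> replaces \<open>arctan (S / p) / p\<close>: both arguments
  stay in the right half plane, so no branch cut is met, and as \<open>S \<longlonglongrightarrow> \<infinity>\<close> the difference of
  logarithms tends to \<open>Ln i - Ln (- i) = i \<pi>\<close>.\<close>

lemma integral_sqrt_kernel:
  fixes p :: complex
  assumes p: "Re p > 0"
  shows "(LINT y:{t\<^sup>2 / 4<..}|lborel.
     1 / (complex_of_real (sqrt (4 * y - t\<^sup>2)) * (complex_of_real (sqrt (4 * y - t\<^sup>2)) ^ 2 + p\<^sup>2)))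
     = pi / (4 * p)"
proof -
  let ?S = "\<lambda>y. sqrt (4 * y - t\<^sup>2)"
  let ?A = "\<lambda>s. (Ln (p + \<i> * of_real s) - Ln (p - \<i> * of_real s)) / (4 * \<i> * p)"
  have p0: "p \<noteq> 0" using p by auto
  have nz: "p + \<i> * of_real s \<noteq> 0" "p - \<i> * of_real s \<noteq> 0"
       "p + \<i> * of_real s \<notin> \<real>\<^sub>\<le>\<^sub>0" "p - \<i> * of_real s \<notin> \<real>\<^sub>\<le>\<^sub>0" for s
    using p by (auto simp: complex_eq_iff complex_nonpos_Reals_iff)
  have dA: "(?A has_vector_derivative 1 / (2 * (of_real s ^ 2 + p\<^sup>2))) (at s)" for s
  proof -
    have d1: "((\<lambda>z. (Ln (p + \<i> * z) - Ln (p - \<i> * z)) / (4 * \<i> * p)) has_field_derivative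
       (\<i> / (p + \<i> * s) + \<i> / (p - \<i> * s)) / (4 * \<i> * p)) (at (of_real s))"
      using nz[of s] p0 by (auto intro!: derivative_eq_intros simp: divide_simps)
    have eq: "complex_of_real s ^ 2 + p\<^sup>2 = (p + \<i> * s) * (p - \<i> * s)"
      by (simp add: algebra_simps power2_eq_square)
    have "\<i> / (p + \<i> * s) + \<i> / (p - \<i> * s) = 2 * \<i> * p / ((p + \<i> * s) * (p - \<i> * s))"
      using nz[of s] by (simp add: divide_simps) (simp add: algebra_simps)
    then have "(\<i> / (p + \<i> * s) + \<i> / (p - \<i> * s)) / (4 * \<i> * p) = 1 / (2 * (of_real s ^ 2 + p\<^sup>2))"
      unfolding eq using nz[of s] p0 by (simp add: divide_simps)
    with d1 show ?thesis
      using has_vector_derivative_real_field[of _ _ s UNIV] by simp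
  qed
  have lim: "(?A \<longlongrightarrow> pi / (4 * p)) at_top"
  proof -
    have "((\<lambda>s. (Ln (p / of_real s + \<i>) - Ln (p / of_real s - \<i>)) / (4 * \<i> * p)) \<longlongrightarrow> 
             (Ln (0 + \<i>) - Ln (0 - \<i>)) / (4 * \<i> * p)) (at_top :: real filter)"
    proof (intro tendsto_intros)
      have "((\<lambda>s::real. inverse s) \<longlongrightarrow> 0) at_top" by real_asymp
      then have "((\<lambda>s. p * complex_of_real (inverse s)) \<longlongrightarrow> p * of_real 0) at_top"
        by (intro tendsto_intros)
      then show "((\<lambda>s. p / complex_of_real s) \<longlongrightarrow> 0) at_top" 
         "((\<lambda>s. p / complex_of_real s) \<longlongrightarrow> 0) at_top" by (simp_all add: divide_inverse)
    qed (use p0 in \<open>auto simp: complex_nonpos_Reals_iff\<close>)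
    moreover have "(Ln (0 + \<i>) - Ln (0 - \<i>)) / (4 * \<i> * p) = pi / (4 * p)"
      using p0 by (simp add: field_simps)
    moreover have "\<forall>\<^sub>F s in at_top. (Ln (p / of_real s + \<i>) - Ln (p / of_real s - \<i>)) / (4 * \<i> * p) = ?A s"
      using eventually_gt_at_top[of 0]
    proof eventually_elim
      case (elim s)
      have e: "p + \<i> * s = of_real s * (p / s + \<i>)" "p - \<i> * s = of_real s * (p / s - \<i>)"
        using elim by (auto simp: field_simps)
      have "p / s + \<i> \<noteq> 0" "p / s - \<i> \<noteq> 0" using e nz[of s] by auto
      then show ?case unfolding e using elim
        Ln_times_of_real[of s "p / s + \<i>"] Ln_times_of_real[of s "p / s - \<i>"] by simp
    qed
    ultimately show ?thesis using Lim_transform_eventually by fastforce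
  qed
  have "(LBINT y=ereal (t\<^sup>2 / 4)..\<infinity>. 1 / (complex_of_real (?S y) * (complex_of_real (?S y) ^ 2 + p\<^sup>2))) = pi / (4 * p) - 0"
  proof (rule interval_integral_FTC_integrable[where F = "\<lambda>y. ?A (?S y)"])
    fix x assume "ereal (t\<^sup>2 / 4) < ereal x" "ereal x < \<infinity>"
    then have x: "x > t\<^sup>2 / 4" by simp
    then have pos: "?S x > 0" by simp
    have "(?A \<circ> ?S has_vector_derivative (2 / ?S x) *\<^sub>R (1 / (2 * (of_real (?S x) ^ 2 + p\<^sup>2)))) (at x)"
      by (rule vector_diff_chain_at[OF _ dA])
         (use has_real_derivative_sqrt_edge[OF x] has_real_derivative_iff_has_vector_derivative in blast)
    moreover have "(2 / ?S x) *\<^sub>R (1 / (2 * (of_real (?S x) ^ 2 + p\<^sup>2))) = 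
       1 / (complex_of_real (?S x) * (complex_of_real (?S x) ^ 2 + p\<^sup>2))"
    proof -
      have "(2 / a) *\<^sub>R (1 / (2 * w)) = 1 / (of_real a * w)" if "a \<noteq> 0" "w \<noteq> 0" for a :: real and w :: complex
        using that by (simp add: scaleR_conv_of_real)
      from this[of "?S x" "of_real (?S x) ^ 2 + p\<^sup>2"] show ?thesis
        using pos norm_quadratic_nonzero[OF p, of "?S x"] by simp
    qed
    ultimately show "((\<lambda>y. ?A (?S y)) has_vector_derivative
         1 / (complex_of_real (?S x) * (complex_of_real (?S x) ^ 2 + p\<^sup>2))) (at x)"
      by (simp add: o_def)
    show "isCont (\<lambda>y. 1 / (complex_of_real (?S y) * (complex_of_real (?S y) ^ 2 + p\<^sup>2))) x"
      using pos norm_quadratic_nonzero[OF p, of "?S x"] by (intro continuous_intros) auto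
  next
    show "set_integrable lborel (einterval (ereal (t\<^sup>2 / 4)) \<infinity>)
     (\<lambda>y. 1 / (complex_of_real (?S y) * (complex_of_real (?S y) ^ 2 + p\<^sup>2)))"
      unfolding einterval_Ioi by (rule integrable_sqrt_kernel[OF p])
  next
    have c: "continuous_on UNIV ?A"
      by (rule continuous_at_imp_continuous_on) (use dA in \<open>auto intro: has_vector_derivative_continuous\<close>)
    have "(?S \<longlongrightarrow> ?S (t\<^sup>2 / 4)) (at_right (t\<^sup>2 / 4))"
      by (intro tendsto_intros)
    then have "((\<lambda>y. ?A (?S y)) \<longlongrightarrow> ?A (?S (t\<^sup>2 / 4))) (at_right (t\<^sup>2 / 4))"
      by (rule continuous_on_tendsto_compose[OF c]) auto
    then show "(((\<lambda>y. ?A (?S y)) \<circ> real_of_ereal) \<longlongrightarrow> 0) (at_right (ereal (t\<^sup>2 / 4)))"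
      by (simp add: ereal_tendsto_simps)
  next
    have "filterlim ?S at_top at_top" by real_asymp
    then have "((\<lambda>y. ?A (?S y)) \<longlongrightarrow> pi / (4 * p)) at_top"
      by (rule filterlim_compose[OF lim])
    then show "(((\<lambda>y. ?A (?S y)) \<circ> real_of_ereal) \<longlongrightarrow> pi / (4 * p)) (at_left \<infinity>)"
      by (simp add: ereal_tendsto_simps)
  qed auto
  then show ?thesis by (simp add: interval_integral_to_infinity_eq)
qed

lemma partial_fractions_three:
  fixes X A B C :: "'a :: field"
  assumes "A \<noteq> B" "A \<noteq> C" "B \<noteq> C" "X + A \<noteq> 0" "X + B \<noteq> 0" "X + C \<noteq> 0"
  shows "X / ((X + A) * (X + B) * (X + C)) = 
    - A / ((B - A) * (C - A)) / (X + A) + - B / ((A - B) * (C - B)) / (X + B) + - C / ((A - C) * (B - C)) / (X + C)"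
proof -
  define x y z u v w where "x = X + A" and "y = X + B" and "z = X + C" and "u = A - B" and "v = A - C" and "w = B - C"
  have nz: "x \<noteq> 0" "y \<noteq> 0" "z \<noteq> 0" "u \<noteq> 0" "v \<noteq> 0" "w \<noteq> 0"
    using assms by (simp_all add: x_def y_def z_def u_def v_def w_def)
  have diffs: "B - A = - u" "C - A = - v" "C - B = - w" by (simp_all add: u_def v_def w_def)
  have id: "X * (u * v * w) = - A * w * (y * z) + B * v * (x * z) - C * u * (x * y)"
    unfolding x_def y_def z_def u_def v_def w_def by algebra
  have "- A / (- u * - v) / x + - B / (u * - w) / y + - C / (v * w) / z 
     = (- A * w * (y * z) + B * v * (x * z) - C * u * (x * y)) / (u * v * w * (x * y * z))"
    using nz by (simp add: add_divide_distrib diff_divide_distrib mult.assoc)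
  also have "\<dots> = X / (x * y * z)" unfolding id[symmetric] using nz by simp
  finally show ?thesis 
    unfolding diffs x_def[symmetric] y_def[symmetric] z_def[symmetric] u_def[symmetric] v_def[symmetric] w_def[symmetric] ..
qed

text \<open>Partial fractions in the variable \<open>S\<^sup>2\<close> reduce the integral to three instances of
  \<open>integral_sqrt_kernel\<close>; the three values recombine into one product of pairwise sums.\<close>

lemma integral_three_quadratic_factors:
  fixes p q r :: complex
  assumes re: "Re p > 0" "Re q > 0" "Re r > 0"
    and ne: "p \<noteq> q" "p \<noteq> r" "q \<noteq> r"
  shows "(LINT y:{t\<^sup>2 / 4<..}|lborel.
     complex_of_real (sqrt (4 * y - t\<^sup>2)) / 
      ((complex_of_real (sqrt (4 * y - t\<^sup>2)) ^ 2 + p\<^sup>2) * (complex_of_real (sqrt (4 * y - t\<^sup>2)) ^ 2 + q\<^sup>2)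
        * (complex_of_real (sqrt (4 * y - t\<^sup>2)) ^ 2 + r\<^sup>2)))
     = pi / (4 * (p + q) * (q + r) * (p + r))"
proof -
  define S where "S = (\<lambda>y. complex_of_real (sqrt (4 * y - t\<^sup>2)))"
  define a b c where "a = - p\<^sup>2 / ((q\<^sup>2 - p\<^sup>2) * (r\<^sup>2 - p\<^sup>2))" 
    and "b = - q\<^sup>2 / ((p\<^sup>2 - q\<^sup>2) * (r\<^sup>2 - q\<^sup>2))" and "c = - r\<^sup>2 / ((p\<^sup>2 - r\<^sup>2) * (q\<^sup>2 - r\<^sup>2))"
  have sums: "p + q \<noteq> 0" "q + r \<noteq> 0" "p + r \<noteq> 0" "p \<noteq> 0" "q \<noteq> 0" "r \<noteq> 0"
    using re by (auto simp: complex_eq_iff)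
  have sq: "q\<^sup>2 - p\<^sup>2 = - (p + q) * (p - q)" "p\<^sup>2 - q\<^sup>2 = (p + q) * (p - q)"
    "r\<^sup>2 - p\<^sup>2 = - (p + r) * (p - r)" "p\<^sup>2 - r\<^sup>2 = (p + r) * (p - r)"
    "r\<^sup>2 - q\<^sup>2 = - (q + r) * (q - r)" "q\<^sup>2 - r\<^sup>2 = (q + r) * (q - r)"
    by (simp_all add: power2_eq_square algebra_simps)
  have int: "set_integrable lborel {t\<^sup>2 / 4<..} (\<lambda>y. k * (1 / (S y * (S y ^ 2 + w\<^sup>2))))" 
    if "Re w > 0" for k w :: complex
    using integrable_sqrt_kernel[OF that, of t] unfolding S_def by (intro set_integrable_mult_right)
  have val: "(LINT y:{t\<^sup>2 / 4<..}|lborel. k * (1 / (S y * (S y ^ 2 + w\<^sup>2)))) = k * (pi / (4 * w))"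
    if "Re w > 0" for k w :: complex
    using integral_sqrt_kernel[OF that, of t] unfolding S_def by (subst set_integral_mult_right) simp
  have pfd: "s / ((s\<^sup>2 + p\<^sup>2) * (s\<^sup>2 + q\<^sup>2) * (s\<^sup>2 + r\<^sup>2)) = 
      a * (1 / (s * (s\<^sup>2 + p\<^sup>2))) + b * (1 / (s * (s\<^sup>2 + q\<^sup>2))) + c * (1 / (s * (s\<^sup>2 + r\<^sup>2)))"
    if "s \<noteq> 0" "s\<^sup>2 + p\<^sup>2 \<noteq> 0" "s\<^sup>2 + q\<^sup>2 \<noteq> 0" "s\<^sup>2 + r\<^sup>2 \<noteq> 0" for s
  proof -
    have "p\<^sup>2 - q\<^sup>2 \<noteq> 0" "p\<^sup>2 - r\<^sup>2 \<noteq> 0" "q\<^sup>2 - r\<^sup>2 \<noteq> 0"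
      using sums ne unfolding sq by simp_all
    then have "s\<^sup>2 / ((s\<^sup>2 + p\<^sup>2) * (s\<^sup>2 + q\<^sup>2) * (s\<^sup>2 + r\<^sup>2)) = a / (s\<^sup>2 + p\<^sup>2) + b / (s\<^sup>2 + q\<^sup>2) + c / (s\<^sup>2 + r\<^sup>2)"
      unfolding a_def b_def c_def using that by (intro partial_fractions_three) auto
    then have "s\<^sup>2 / ((s\<^sup>2 + p\<^sup>2) * (s\<^sup>2 + q\<^sup>2) * (s\<^sup>2 + r\<^sup>2)) / s = (a / (s\<^sup>2 + p\<^sup>2) + b / (s\<^sup>2 + q\<^sup>2) + c / (s\<^sup>2 + r\<^sup>2)) / s"
      by (rule arg_cong)
    moreover have "s\<^sup>2 / D / s = s / D" "k / D / s = k * (1 / (s * D))" for D k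
      using that(1) by (simp_all add: power2_eq_square)
    ultimately show ?thesis by (simp only: add_divide_distrib)
  qed
  have "(LINT y:{t\<^sup>2 / 4<..}|lborel. S y / ((S y ^ 2 + p\<^sup>2) * (S y ^ 2 + q\<^sup>2) * (S y ^ 2 + r\<^sup>2))) = 
    (LINT y:{t\<^sup>2 / 4<..}|lborel. a * (1 / (S y * (S y ^ 2 + p\<^sup>2))) + b * (1 / (S y * (S y ^ 2 + q\<^sup>2))) 
          + c * (1 / (S y * (S y ^ 2 + r\<^sup>2))))"
  proof (rule set_lebesgue_integral_cong)
    show "\<forall>y. y \<in> {t\<^sup>2 / 4<..} \<longrightarrow> S y / ((S y ^ 2 + p\<^sup>2) * (S y ^ 2 + q\<^sup>2) * (S y ^ 2 + r\<^sup>2)) =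
      a * (1 / (S y * (S y ^ 2 + p\<^sup>2))) + b * (1 / (S y * (S y ^ 2 + q\<^sup>2))) 
          + c * (1 / (S y * (S y ^ 2 + r\<^sup>2)))"
    proof (intro allI impI)
      fix y assume "y \<in> {t\<^sup>2 / 4<..}"
      then have "S y \<noteq> 0" by (auto simp: S_def)
      then show "S y / ((S y ^ 2 + p\<^sup>2) * (S y ^ 2 + q\<^sup>2) * (S y ^ 2 + r\<^sup>2)) =
      a * (1 / (S y * (S y ^ 2 + p\<^sup>2))) + b * (1 / (S y * (S y ^ 2 + q\<^sup>2))) 
          + c * (1 / (S y * (S y ^ 2 + r\<^sup>2)))"
        using norm_quadratic_nonzero re by (intro pfd) (auto simp: S_def)
    qed
  qed simp
  also have "\<dots> = a * (pi / (4 * p)) + b * (pi / (4 * q)) + c * (pi / (4 * r))"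
    using re by (simp only: set_integral_add int val)
  also have "\<dots> = pi / (4 * (p + q) * (q + r) * (p + r))"
  proof -
    have d: "p - q \<noteq> 0" "p - r \<noteq> 0" "q - r \<noteq> 0" using ne by auto
    define u v w P Q R where "u = p - q" and "v = p - r" and "w = q - r" and "P = p + q" and "Q = q + r" and "R = p + r"
    have nz: "u \<noteq> 0" "v \<noteq> 0" "w \<noteq> 0" "P \<noteq> 0" "Q \<noteq> 0" "R \<noteq> 0"
      using d sums by (auto simp: u_def v_def w_def P_def Q_def R_def)
    have id: "- p * (Q * w) + q * (R * v) + - r * (P * u) = u * v * w"
      unfolding u_def v_def w_def P_def Q_def R_def by algebra
    have a: "a * (pi / (4 * p)) = pi * (- p * (Q * w)) / (4 * P * Q * R * (u * v * w))"
      using sums nz unfolding a_def sq u_def[symmetric] v_def[symmetric] w_def[symmetric] P_def[symmetric] Q_def[symmetric] R_def[symmetric]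
      by (simp add: divide_simps power2_eq_square)
    have b: "b * (pi / (4 * q)) = pi * (q * (R * v)) / (4 * P * Q * R * (u * v * w))"
      using sums nz unfolding b_def sq u_def[symmetric] v_def[symmetric] w_def[symmetric] P_def[symmetric] Q_def[symmetric] R_def[symmetric]
      by (simp add: divide_simps power2_eq_square)
    have c: "c * (pi / (4 * r)) = pi * (- r * (P * u)) / (4 * P * Q * R * (u * v * w))"
      using sums nz unfolding c_def sq u_def[symmetric] v_def[symmetric] w_def[symmetric] P_def[symmetric] Q_def[symmetric] R_def[symmetric]
      by (simp add: divide_simps power2_eq_square)
    have "a * (pi / (4 * p)) + b * (pi / (4 * q)) + c * (pi / (4 * r)) = 
        pi * (- p * (Q * w) + q * (R * v) + - r * (P * u)) / (4 * P * Q * R * (u * v * w))"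
      unfolding a b c by (simp only: add_divide_distrib[symmetric] distrib_left[symmetric])
    also have "\<dots> = pi / (4 * P * Q * R)" unfolding id using nz by simp
    finally show ?thesis unfolding P_def Q_def R_def .
  qed
  finally show ?thesis unfolding S_def .
qed

text \<open>The numbers \<open>p, q\<close> are the negatives of the roots of \<open>X\<^sup>2 + \<sigma> X + m\<close>; they are either two
  positive reals or complex conjugates with real part \<open>\<sigma> / 2\<close>.\<close>

lemma quadratic_roots_right_half_plane:
  fixes \<sigma> m :: real
  assumes "\<sigma> > 0" "m > 0"
  obtains p q :: complex where "p + q = \<sigma>" "p * q = m" "Re p > 0" "Re q > 0"
    "\<sigma>\<^sup>2 = 4 * m \<or> p \<noteq> q"
proof -
  define d where "d = csqrt (of_real (\<sigma>\<^sup>2 / 4 - m))"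
  have d2: "d\<^sup>2 = of_real (\<sigma>\<^sup>2 / 4 - m)" unfolding d_def by (rule power2_csqrt)
  have "0 \<le> Re d" unfolding d_def by (rule Re_csqrt)
  have "Re d < \<sigma> / 2"
  proof (cases "\<sigma>\<^sup>2 / 4 - m \<ge> 0")
    case True
    have "sqrt (\<sigma>\<^sup>2 / 4 - m) < \<sigma> / 2"
      using assms by (intro real_less_lsqrt) (auto simp: power2_eq_square)
    then show ?thesis using True unfolding d_def by (subst csqrt_of_real_nonneg) auto
  next
    case False
    then have "d = \<i> * sqrt \<bar>\<sigma>\<^sup>2 / 4 - m\<bar>"
      unfolding d_def by (subst csqrt_of_real_nonpos) auto
    then show ?thesis using assms by simp
  qed
  show ?thesis
  proof (rule that)
    show "\<sigma> / 2 + d + (\<sigma> / 2 - d) = \<sigma>" by simp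
    show "(\<sigma> / 2 + d) * (\<sigma> / 2 - d) = m"
      using d2 by (simp add: algebra_simps power2_eq_square)
    show "0 < Re (\<sigma> / 2 + d)" "0 < Re (\<sigma> / 2 - d)"
      using \<open>0 \<le> Re d\<close> \<open>Re d < \<sigma> / 2\<close> assms by auto
    show "\<sigma>\<^sup>2 = 4 * m \<or> of_real (\<sigma> / 2) + d \<noteq> of_real (\<sigma> / 2) - d"
    proof (cases "d = 0")
      case True
      then have "complex_of_real (\<sigma>\<^sup>2 / 4 - m) = 0" using d2 by simp
      then show ?thesis unfolding of_real_eq_0_iff by simp
    next
      case False
      then have "(of_real (\<sigma> / 2) + d) - (of_real (\<sigma> / 2) - d) \<noteq> 0" by simp
      then show ?thesis unfolding right_minus_eq by (rule disjI2)
    qed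
  qed
qed

lemma quadratic_nonzero:
  fixes \<sigma> m :: real and r :: complex
  assumes "\<sigma> > 0" "m \<ge> 0" "Re r > 0"
  shows "r\<^sup>2 + \<sigma> * r + m \<noteq> 0"
proof
  assume eq: "r\<^sup>2 + \<sigma> * r + m = 0"
  define x y where "x = Re r" and "y = Im r"
  have im: "2 * x * y + \<sigma> * y = 0" and re: "x\<^sup>2 - y\<^sup>2 + \<sigma> * x + m = 0"
    using eq by (auto simp: complex_eq_iff x_def y_def power2_eq_square mult_ac)
  have "(2 * x + \<sigma>) * y = 0" using im by (simp add: algebra_simps)
  then have "y = 0" using assms by (auto simp: x_def)
  moreover have "x\<^sup>2 + \<sigma> * x + m > 0" using assms by (simp add: x_def add_pos_nonneg)
  ultimately show False using re by simp
qed

text \<open>If \<open>p + q = \<sigma>\<close> and \<open>p q = m\<close> then \<open>(m - S\<^sup>2)\<^sup>2 + \<sigma>\<^sup>2 S\<^sup>2 = (S\<^sup>2 + p\<^sup>2) (S\<^sup>2 + q\<^sup>2)\<close>, and the previous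
  integral equals \<open>\<pi> / (4 \<sigma> (r + p) (r + q))\<close>.  This needs \<open>p, q, r\<close> distinct and \<open>m > 0\<close>, which
  fails for at most three values of \<open>m\<close>.  The excluded values, one of which is the case \<open>p = q\<close> of
  the measures of the semigroup, follow by letting the parameter decrease to \<open>m\<close>: the bound
  \<open>S / ((m - S\<^sup>2)\<^sup>2 + \<sigma>\<^sup>2 S\<^sup>2) \<le> 1 / (\<sigma>\<^sup>2 S)\<close> is uniform in the parameter.\<close>

lemma quartic_kernel_transform:
  fixes t \<sigma> m :: real and r :: complex
  assumes \<sigma>: "\<sigma> > 0" and m: "m \<ge> 0" and r: "Re r > 0"
  defines "S \<equiv> \<lambda>y. sqrt (4 * y - t\<^sup>2)"
  shows "set_integrable lborel {t\<^sup>2 / 4<..}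
      (\<lambda>y. of_real (S y / ((m - (S y)\<^sup>2)\<^sup>2 + \<sigma>\<^sup>2 * (S y)\<^sup>2)) / ((of_real (S y))\<^sup>2 + r\<^sup>2))"
   and "(LINT y:{t\<^sup>2 / 4<..}|lborel.
         of_real (S y / ((m - (S y)\<^sup>2)\<^sup>2 + \<sigma>\<^sup>2 * (S y)\<^sup>2)) / ((of_real (S y))\<^sup>2 + r\<^sup>2))
        = pi / (4 * \<sigma> * (r\<^sup>2 + \<sigma> * r + m))"
proof -
  define f where "f = (\<lambda>m' y. of_real (S y / ((m' - (S y)\<^sup>2)\<^sup>2 + \<sigma>\<^sup>2 * (S y)\<^sup>2)) / ((of_real (S y))\<^sup>2 + r\<^sup>2))"
  define X where "X = (\<lambda>n::nat. m + 1 / (real n + 1))"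
  have Xlim: "filterlim X (at_right m) sequentially"
  proof -
    have "X \<longlonglongrightarrow> m + 0" unfolding X_def by (intro tendsto_intros) real_asymp
    then show ?thesis by (auto simp: filterlim_at X_def)
  qed
  then have Xlim': "X \<longlonglongrightarrow> m" by (simp add: filterlim_at)
  have generic: "(LINT y:{t\<^sup>2 / 4<..}|lborel. f m' y) = pi / (4 * \<sigma> * (r\<^sup>2 + \<sigma> * r + m'))"
    if m': "m' > 0" "m' \<noteq> \<sigma>\<^sup>2 / 4" "m' \<noteq> Re (\<sigma> * r - r\<^sup>2)" for m'
  proof -
    obtain p q :: complex where pq: "p + q = \<sigma>" "p * q = m'" "Re p > 0" "Re q > 0" "\<sigma>\<^sup>2 = 4 * m' \<or> p \<noteq> q"
      by (rule quadratic_roots_right_half_plane[OF \<sigma> m'(1)])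
    have "p \<noteq> q" using pq(5) m'(2) by auto
    have ne: "w \<noteq> r" if "w = p \<or> w = q" for w
    proof
      assume "w = r"
      have "\<sigma> * w - w\<^sup>2 = m'" 
        using that unfolding pq(1,2)[symmetric] by (auto simp: power2_eq_square algebra_simps)
      then have "\<sigma> * r - r\<^sup>2 = m'" using \<open>w = r\<close> by simp
      then show False using m'(3) by (metis Re_complex_of_real)
    qed
    have f: "f m' y = of_real (S y) / (((of_real (S y))\<^sup>2 + p\<^sup>2) * ((of_real (S y))\<^sup>2 + q\<^sup>2) * ((of_real (S y))\<^sup>2 + r\<^sup>2))" for y
    proof -
      have "of_real ((m' - (S y)\<^sup>2)\<^sup>2 + \<sigma>\<^sup>2 * (S y)\<^sup>2) = ((of_real (S y))\<^sup>2 + p\<^sup>2) * ((of_real (S y))\<^sup>2 + q\<^sup>2)"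
        unfolding of_real_add of_real_power of_real_diff of_real_mult pq(1,2)[symmetric]
        by (simp add: algebra_simps power2_eq_square)
      then show ?thesis unfolding f_def of_real_divide by simp
    qed
    have "(p + q) * (q + r) * (p + r) = \<sigma> * (r\<^sup>2 + \<sigma> * r + m')"
      unfolding pq(1,2)[symmetric] by (simp add: algebra_simps power2_eq_square)
    then have "4 * (p + q) * (q + r) * (p + r) = 4 * \<sigma> * (r\<^sup>2 + \<sigma> * r + m')"
      by (simp only: mult.assoc of_real_mult of_real_numeral)
    then show ?thesis using integral_three_quadratic_factors[OF pq(3,4) r \<open>p \<noteq> q\<close> ne ne, of t]
      unfolding f S_def by simp
  qed
  have ev: "\<forall>\<^sub>F n in sequentially. (LINT y:{t\<^sup>2 / 4<..}|lborel. f (X n) y) = pi / (4 * \<sigma> * (r\<^sup>2 + \<sigma> * r + X n))"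
  proof -
    have "\<forall>\<^sub>F x in at_right m. x > 0 \<and> x \<noteq> \<sigma>\<^sup>2 / 4 \<and> x \<noteq> Re (\<sigma> * r - r\<^sup>2)"
      using eventually_at_right_less[of m] m
      by (intro eventually_conj eventually_neq_at_within) (auto elim: eventually_mono)
    from eventually_compose_filterlim[OF this Xlim] show ?thesis
      by eventually_elim (rule generic, auto)
  qed
  define w where "w = (\<lambda>y. norm (indicator {t\<^sup>2 / 4<..} y *\<^sub>R (1 / (complex_of_real (S y) * (complex_of_real (S y) ^ 2 + r\<^sup>2)))) / \<sigma>\<^sup>2)"
  have wint: "integrable lborel w"
    unfolding w_def using integrable_sqrt_kernel[OF r, of t]
    by (intro integrable_divide_zero integrable_norm) (simp add: S_def set_integrable_def)
  have bound: "norm (indicator {t\<^sup>2 / 4<..} y *\<^sub>R f m' y) \<le> w y" for m' y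
  proof (cases "y > t\<^sup>2 / 4")
    case True
    then have s: "S y > 0" by (simp add: S_def)
    define s n where "s = S y" and "n = norm ((complex_of_real s)\<^sup>2 + r\<^sup>2)"
    have s: "s > 0" and n: "n > 0" using s norm_quadratic_nonzero[OF r, of s] by (auto simp: s_def n_def)
    have D: "(m' - s\<^sup>2)\<^sup>2 + \<sigma>\<^sup>2 * s\<^sup>2 \<ge> \<sigma>\<^sup>2 * s\<^sup>2" "\<sigma>\<^sup>2 * s\<^sup>2 > 0" using s \<sigma> by auto
    then have "(m' - s\<^sup>2)\<^sup>2 + \<sigma>\<^sup>2 * s\<^sup>2 > 0" by linarith
    then have "((m' - s\<^sup>2)\<^sup>2 + \<sigma>\<^sup>2 * s\<^sup>2) * (\<sigma>\<^sup>2 * s\<^sup>2) > 0" using D(2) by (rule mult_pos_pos)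
    then have "s / ((m' - s\<^sup>2)\<^sup>2 + \<sigma>\<^sup>2 * s\<^sup>2) \<le> s / (\<sigma>\<^sup>2 * s\<^sup>2)"
      using D(1) s by (intro divide_left_mono) auto
    note le = divide_right_mono[OF this, of n]
    have "norm (f m' y) = s / ((m' - s\<^sup>2)\<^sup>2 + \<sigma>\<^sup>2 * s\<^sup>2) / n"
      using s D by (simp only: f_def norm_divide s_def[symmetric] n_def[symmetric] norm_of_real) simp
    also have "\<dots> \<le> s / (\<sigma>\<^sup>2 * s\<^sup>2) / n" using le n by simp
    also have "\<dots> = 1 / (s * n) / \<sigma>\<^sup>2" using s \<sigma> by (simp add: power2_eq_square)
    also have "\<dots> = w y" using True s by (simp add: w_def s_def[symmetric] n_def norm_divide norm_mult)
    finally show ?thesis using True by simp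
  qed (auto simp: w_def)
  have meas[measurable]: "f m' \<in> borel_measurable lborel" for m'
    unfolding f_def S_def by measurable
  have lim: "AE y in lborel. (\<lambda>n. indicator {t\<^sup>2 / 4<..} y *\<^sub>R f (X n) y) \<longlonglongrightarrow> indicator {t\<^sup>2 / 4<..} y *\<^sub>R f m y"
  proof (rule AE_I2)
    fix y
    show "(\<lambda>n. indicat_real {t\<^sup>2 / 4<..} y *\<^sub>R f (X n) y) \<longlonglongrightarrow> indicat_real {t\<^sup>2 / 4<..} y *\<^sub>R f m y"
    proof (cases "y > t\<^sup>2 / 4")
      case True
      then have s: "S y > 0" by (simp add: S_def)
      then have "(m - (S y)\<^sup>2)\<^sup>2 + \<sigma>\<^sup>2 * (S y)\<^sup>2 > 0" using \<sigma> by (intro add_nonneg_pos) auto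
      then have "(\<lambda>n. f (X n) y) \<longlonglongrightarrow> f m y" unfolding f_def 
        using norm_quadratic_nonzero[OF r, of "S y"]
        by (intro tendsto_intros Xlim') auto
      then show ?thesis using True by simp
    qed simp
  qed
  have A: "integrable lborel (\<lambda>y. indicator {t\<^sup>2 / 4<..} y *\<^sub>R f m y)"
    by (rule integrable_dominated_convergence[OF _ _ wint lim]) (use bound in simp_all)
  have B: "(\<lambda>n. LINT y|lborel. indicator {t\<^sup>2 / 4<..} y *\<^sub>R f (X n) y) \<longlonglongrightarrow> (LINT y|lborel. indicator {t\<^sup>2 / 4<..} y *\<^sub>R f m y)"
    by (rule integral_dominated_convergence[OF _ _ wint lim]) (use bound in simp_all)
  show "set_integrable lborel {t\<^sup>2 / 4<..}
      (\<lambda>y. of_real (S y / ((m - (S y)\<^sup>2)\<^sup>2 + \<sigma>\<^sup>2 * (S y)\<^sup>2)) / ((of_real (S y))\<^sup>2 + r\<^sup>2))"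
    using A by (simp add: set_integrable_def f_def)
  have C: "(\<lambda>n. pi / (4 * \<sigma> * (r\<^sup>2 + \<sigma> * r + X n))) \<longlonglongrightarrow> pi / (4 * \<sigma> * (r\<^sup>2 + \<sigma> * r + m))"
    using quadratic_nonzero[OF \<sigma> m r] \<sigma> by (intro tendsto_intros Xlim') auto
  have "(\<lambda>n. pi / (4 * \<sigma> * (r\<^sup>2 + \<sigma> * r + X n))) \<longlonglongrightarrow> (LINT y:{t\<^sup>2 / 4<..}|lborel. f m y)"
    using Lim_transform_eventually[OF B] ev unfolding set_lebesgue_integral_def by simp
  then have "(LINT y:{t\<^sup>2 / 4<..}|lborel. f m y) = pi / (4 * \<sigma> * (r\<^sup>2 + \<sigma> * r + m))"
    using C LIMSEQ_unique by blast
  then show "(LINT y:{t\<^sup>2 / 4<..}|lborel.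
         of_real (S y / ((m - (S y)\<^sup>2)\<^sup>2 + \<sigma>\<^sup>2 * (S y)\<^sup>2)) / ((of_real (S y))\<^sup>2 + r\<^sup>2))
        = pi / (4 * \<sigma> * (r\<^sup>2 + \<sigma> * r + m))"
    by (simp add: f_def)
qed

section \<open>Square-root densities and their Cauchy transforms\<close>

text \<open>The density found by Stieltjes inversion of \<open>- 4 / (r\<^sup>2 + \<sigma> r + m)\<close>, where
  \<open>r = csqrt (t\<^sup>2 - 4 z)\<close> has boundary value \<open>- i S\<close> at a real \<open>z > t\<^sup>2 / 4\<close>.  The measures of the semigroup have
  \<open>\<sigma> = 2 t\<close>, \<open>m = t\<^sup>2\<close>; the transition kernels have \<open>\<sigma> = 2 (t - s)\<close>, \<open>m = (t - s)\<^sup>2 - s\<^sup>2 + 4 x\<close>.\<close>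

definition half_density :: "real \<Rightarrow> real \<Rightarrow> real \<Rightarrow> real \<Rightarrow> real" where
  "half_density t \<sigma> m y = indicator {t\<^sup>2 / 4<..} y *
     (4 * \<sigma> / pi * (sqrt (4 * y - t\<^sup>2) / ((m - (sqrt (4 * y - t\<^sup>2))\<^sup>2)\<^sup>2 + \<sigma>\<^sup>2 * (sqrt (4 * y - t\<^sup>2))\<^sup>2)))"

lemma half_density_measurable [measurable]: "half_density t \<sigma> m \<in> borel_measurable borel"
  unfolding half_density_def by measurable

lemma half_density_nonneg: "\<sigma> > 0 \<Longrightarrow> half_density t \<sigma> m y \<ge> 0"
  unfolding half_density_def by (auto simp: indicator_def)

lemma half_density_transform:
  assumes "\<sigma> > 0" "m \<ge> 0" "Re r > 0"
  shows "integrable lborel (\<lambda>y. of_real (half_density t \<sigma> m y) / (of_real (4 * y - t\<^sup>2) + r\<^sup>2))"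
    and "(LINT y|lborel. of_real (half_density t \<sigma> m y) / (of_real (4 * y - t\<^sup>2) + r\<^sup>2)) = 1 / (r\<^sup>2 + \<sigma> * r + m)"
proof -
  let ?S = "\<lambda>y. sqrt (4 * y - t\<^sup>2)"
  have eq: "of_real (half_density t \<sigma> m y) / (of_real (4 * y - t\<^sup>2) + r\<^sup>2) =
     complex_of_real (4 * \<sigma> / pi) * (indicator {t\<^sup>2 / 4<..} y *\<^sub>R (of_real (?S y / ((m - (?S y)\<^sup>2)\<^sup>2 + \<sigma>\<^sup>2 * (?S y)\<^sup>2)) / ((of_real (?S y))\<^sup>2 + r\<^sup>2)))" for y
  proof (cases "y > t\<^sup>2 / 4")
    case True
    then have "(complex_of_real (?S y))\<^sup>2 = of_real (4 * y - t\<^sup>2)"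
      by (simp flip: of_real_power)
    then show ?thesis using True by (simp add: half_density_def)
  qed (simp add: half_density_def)
  show "integrable lborel (\<lambda>y. of_real (half_density t \<sigma> m y) / (of_real (4 * y - t\<^sup>2) + r\<^sup>2))"
    unfolding eq using quartic_kernel_transform(1)[OF assms, of t]
    by (intro integrable_mult_right) (simp add: set_integrable_def)
  show "(LINT y|lborel. of_real (half_density t \<sigma> m y) / (of_real (4 * y - t\<^sup>2) + r\<^sup>2)) = 1 / (r\<^sup>2 + \<sigma> * r + m)"
    unfolding eq integral_mult_right_zero
      quartic_kernel_transform(2)[OF assms, of t, unfolded set_lebesgue_integral_def]
    using assms(1) by simp
qed

text \<open>The total mass is read off from the transform along real \<open>r \<longlonglongrightarrow> \<infinity>\<close>: there
  \<open>r\<^sup>2 / (S\<^sup>2 + r\<^sup>2)\<close> increases to \<open>1\<close> and \<open>r\<^sup>2 / (r\<^sup>2 + \<sigma> r + m)\<close> tends to \<open>1\<close>.  Monotone convergence gives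
  integrability at the same time.\<close>

lemma half_density_total:
  assumes "\<sigma> > 0" "m \<ge> 0"
  shows "integrable lborel (half_density t \<sigma> m)" "(LINT y|lborel. half_density t \<sigma> m y) = 1"
proof -
  define h where "h = (\<lambda>n y. half_density t \<sigma> m y * ((real n + 1)\<^sup>2 / (4 * y - t\<^sup>2 + (real n + 1)\<^sup>2)))"
  have c: "complex_of_real (half_density t \<sigma> m y / (4 * y - t\<^sup>2 + (real n + 1)\<^sup>2)) = 
      of_real (half_density t \<sigma> m y) / (of_real (4 * y - t\<^sup>2) + (complex_of_real (real n + 1))\<^sup>2)" for n y
    by simp
  have i0: "integrable lborel (\<lambda>y. half_density t \<sigma> m y / (4 * y - t\<^sup>2 + (real n + 1)\<^sup>2))"
    and v0: "(LINT y|lborel. half_density t \<sigma> m y / (4 * y - t\<^sup>2 + (real n + 1)\<^sup>2)) = 1 / ((real n + 1)\<^sup>2 + \<sigma> * (real n + 1) + m)" for n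
  proof -
    have r: "Re (complex_of_real (real n + 1)) > 0" by simp
    show "integrable lborel (\<lambda>y. half_density t \<sigma> m y / (4 * y - t\<^sup>2 + (real n + 1)\<^sup>2))"
      using half_density_transform(1)[OF assms r, of t] unfolding c[symmetric] complex_of_real_integrable_eq .
    have "complex_of_real (LINT y|lborel. half_density t \<sigma> m y / (4 * y - t\<^sup>2 + (real n + 1)\<^sup>2)) = 
      complex_of_real (1 / ((real n + 1)\<^sup>2 + \<sigma> * (real n + 1) + m))"
      using half_density_transform(2)[OF assms r, of t] unfolding c[symmetric] integral_complex_of_real by simp
    then show "(LINT y|lborel. half_density t \<sigma> m y / (4 * y - t\<^sup>2 + (real n + 1)\<^sup>2)) = 1 / ((real n + 1)\<^sup>2 + \<sigma> * (real n + 1) + m)"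
      unfolding of_real_eq_iff .
  qed
  have h: "h n y = (real n + 1)\<^sup>2 * (half_density t \<sigma> m y / (4 * y - t\<^sup>2 + (real n + 1)\<^sup>2))" for n y
    by (simp add: h_def)
  have i: "integrable lborel (h n)" 
    and v: "(LINT y|lborel. h n y) = (real n + 1)\<^sup>2 / ((real n + 1)\<^sup>2 + \<sigma> * (real n + 1) + m)" for n
    unfolding h by (intro integrable_mult_right i0, simp only: integral_mult_right_zero v0, simp)
  have mono: "mono (\<lambda>n. h n y)" for y
  proof (rule monoI)
    fix k n :: nat assume kn: "k \<le> n"
    show "h k y \<le> h n y"
    proof (cases "y > t\<^sup>2 / 4")
      case True
      have "(real k + 1)\<^sup>2 \<le> (real n + 1)\<^sup>2" "(real k + 1)\<^sup>2 > 0" using kn by (auto intro: power_mono)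
      moreover have "A / (a + A) \<le> B / (a + B)" if "A \<le> B" "A > 0" "a > 0" for a A B :: real
        using that by (simp add: divide_simps add_pos_pos algebra_simps)
      ultimately have "(real k + 1)\<^sup>2 / (4 * y - t\<^sup>2 + (real k + 1)\<^sup>2) \<le> (real n + 1)\<^sup>2 / (4 * y - t\<^sup>2 + (real n + 1)\<^sup>2)"
        using True by simp
      then show ?thesis unfolding h_def using half_density_nonneg[OF assms(1)] by (intro mult_left_mono)
    qed (simp add: h_def half_density_def)
  qed
  have lim: "(\<lambda>n. h n y) \<longlonglongrightarrow> half_density t \<sigma> m y" for y
  proof -
    define a where "a = 4 * y - t\<^sup>2"
    have "(\<lambda>n. (real n + 1)\<^sup>2 / (a + (real n + 1)\<^sup>2)) \<longlonglongrightarrow> 1" by real_asymp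
    then show ?thesis unfolding h_def a_def[symmetric] using tendsto_mult_left by fastforce
  qed
  have vlim: "(\<lambda>n. LINT y|lborel. h n y) \<longlonglongrightarrow> 1"
    unfolding v by real_asymp
  show "integrable lborel (half_density t \<sigma> m)"
    by (rule integrable_monotone_convergence[OF i AE_I2[OF mono] AE_I2[OF lim] vlim]) simp
  show "(LINT y|lborel. half_density t \<sigma> m y) = 1"
    by (rule integral_monotone_convergence[OF i AE_I2[OF mono] AE_I2[OF lim] vlim]) simp
qed

definition half_measure :: "real \<Rightarrow> real \<Rightarrow> real \<Rightarrow> real measure" where
  "half_measure t \<sigma> m = density lborel (\<lambda>y. ennreal (half_density t \<sigma> m y))"

lemma real_prob_half_measure:
  assumes "\<sigma> > 0" "m \<ge> 0"
  shows "real_prob (half_measure t \<sigma> m)"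
  unfolding real_prob_def
proof
  show "sets (half_measure t \<sigma> m) = sets borel" by (simp add: half_measure_def)
  have "(\<integral>\<^sup>+ y. ennreal (half_density t \<sigma> m y) \<partial>lborel) = ennreal (LINT y|lborel. half_density t \<sigma> m y)"
    using half_density_total(1)[OF assms] half_density_nonneg[OF assms(1)]
    by (intro nn_integral_eq_integral) auto
  then show "prob_space (half_measure t \<sigma> m)"
    using half_density_total(2)[OF assms]
    by (intro prob_spaceI) (simp add: half_measure_def emeasure_density)
qed

text \<open>For \<open>z\<close> in the upper half plane, \<open>t\<^sup>2 - 4 z\<close> lies in the lower one, away from the branch cut.\<close>

lemma csqrt_upper_half_plane:
  assumes "Im z > 0"
  shows "Re (csqrt (of_real t ^ 2 - 4 * z)) > 0" "Im (csqrt (of_real t ^ 2 - 4 * z)) < 0"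
    "(csqrt (of_real t ^ 2 - 4 * z))\<^sup>2 = of_real t ^ 2 - 4 * z"
proof -
  let ?r = "csqrt (of_real t ^ 2 - 4 * z)"
  show sq: "?r\<^sup>2 = of_real t ^ 2 - 4 * z" by (rule power2_csqrt)
  then have "Im (?r\<^sup>2) = - 4 * Im z" by (simp flip: of_real_power)
  then have im: "2 * Re ?r * Im ?r < 0" using assms by (simp add: power2_eq_square)
  moreover have "Re ?r \<ge> 0" by (rule Re_csqrt)
  ultimately show "Re ?r > 0" by (cases "Re ?r = 0") auto
  with im show "Im ?r < 0" by (simp add: mult_less_0_iff)
qed

text \<open>On the support, \<open>z - y = - (S\<^sup>2 + r\<^sup>2) / 4\<close> with \<open>r\<^sup>2 = t\<^sup>2 - 4 z\<close>, which turns the Cauchy kernel into the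
  kernel already integrated.\<close>

lemma cauchy_transform_half_measure:
  fixes t \<sigma> m :: real and r z :: complex
  assumes "\<sigma> > 0" "m \<ge> 0" "Im z > 0"
  defines "r \<equiv> csqrt (of_real t ^ 2 - 4 * z)"
  shows "cauchy_transform (half_measure t \<sigma> m) z = - 4 / (r\<^sup>2 + \<sigma> * r + m)"
proof -
  have r: "Re r > 0" "r\<^sup>2 = of_real t ^ 2 - 4 * z" using csqrt_upper_half_plane[OF assms(3)] by (auto simp: r_def)
  have zy: "1 / (z - of_real y) = - 4 / (of_real (4 * y - t\<^sup>2) + r\<^sup>2)" for y
  proof -
    have "of_real (4 * y - t\<^sup>2) + r\<^sup>2 = - 4 * (z - of_real y)" unfolding r(2) by simp
    then show ?thesis by (simp only: mult_divide_mult_cancel_left_if) (simp add: divide_simps)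
  qed
  have "cauchy_transform (half_measure t \<sigma> m) z = 
     (LINT y|lborel. half_density t \<sigma> m y *\<^sub>R (1 / (z - of_real y)))"
    unfolding cauchy_transform_def half_measure_def
    using half_density_nonneg[OF assms(1)] by (intro integral_density) auto
  also have "\<dots> = (LINT y|lborel. - 4 * (of_real (half_density t \<sigma> m y) / (of_real (4 * y - t\<^sup>2) + r\<^sup>2)))"
    unfolding zy by (simp add: scaleR_conv_of_real mult.commute)
  also have "\<dots> = - 4 * (1 / (r\<^sup>2 + \<sigma> * r + m))"
    by (simp only: integral_mult_right_zero half_density_transform(2)[OF assms(1,2) r(1)])
  finally show ?thesis by simp
qed

section \<open>A measure is determined by its Cauchy transform\<close>

lemma real_probD:
  assumes "real_prob \<mu>"
  shows "prob_space \<mu>" "sets \<mu> = sets borel" "space \<mu> = UNIV" "f \<in> borel_measurable borel \<Longrightarrow> f \<in> borel_measurable \<mu>"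
  using assms sets_eq_imp_space_eq[of \<mu> borel] by (auto simp: real_prob_def measurable_def)

lemma integrable_cauchy_kernel:
  assumes "real_prob \<mu>" "Im z > 0"
  shows "integrable \<mu> (\<lambda>x. 1 / (z - complex_of_real x))"
proof -
  interpret prob_space \<mu> by (rule real_probD(1)[OF assms(1)])
  show ?thesis
  proof (rule integrable_const_bound[where B = "1 / Im z"])
    show "AE x in \<mu>. norm (1 / (z - complex_of_real x)) \<le> 1 / Im z"
    proof (rule AE_I2)
      fix x
      have "Im z \<le> norm (z - of_real x)" using abs_Im_le_cmod[of "z - of_real x"] by simp
      then show "norm (1 / (z - complex_of_real x)) \<le> 1 / Im z"
        using assms(2) by (simp add: norm_divide divide_simps)
    qed
    show "(\<lambda>x. 1 / (z - complex_of_real x)) \<in> borel_measurable \<mu>"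
      by (intro real_probD(4)[OF assms(1)]) measurable
  qed
qed

text \<open>The mixture is the law of a variable that equals \<open>a\<close> when an independent coin with success
  probability \<open>c\<close> succeeds, and has law \<open>\<mu>\<close> otherwise.\<close>

lemma exists_atom_mixture:
  fixes a c :: real
  assumes \<mu>: "real_prob \<mu>" and c: "0 \<le> c" "c \<le> 1"
  shows "\<exists>\<rho>. real_prob \<rho> \<and> (\<forall>z :: complex. Im z > 0 \<longrightarrow>
    cauchy_transform \<rho> z = c / (z - of_real a) + (1 - c) * cauchy_transform \<mu> z)"
proof -
  interpret M: prob_space \<mu> by (rule real_probD(1)[OF \<mu>])
  interpret B: prob_space "measure_pmf (bernoulli_pmf c)" by (rule prob_space_measure_pmf)
  interpret P: pair_prob_space "measure_pmf (bernoulli_pmf c)" \<mu> ..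
  note [measurable_cong] = real_probD(2)[OF \<mu>]
  define g where "g = (\<lambda>(b, x). if b then a else x)"
  have g[measurable]: "g \<in> borel_measurable (measure_pmf (bernoulli_pmf c) \<Otimes>\<^sub>M \<mu>)"
    unfolding g_def by measurable
  define \<rho> where "\<rho> = distr (measure_pmf (bernoulli_pmf c) \<Otimes>\<^sub>M \<mu>) borel g"
  have "real_prob \<rho>" unfolding real_prob_def \<rho>_def by (simp add: P.prob_space_distr)
  moreover have "cauchy_transform \<rho> z = c / (z - of_real a) + (1 - c) * cauchy_transform \<mu> z" if z: "Im z > 0" for z :: complex
  proof -
    have int: "integrable \<rho> (\<lambda>x. 1 / (z - complex_of_real x))"
      by (rule integrable_cauchy_kernel[OF \<open>real_prob \<rho>\<close> z])
    have int2: "integrable (measure_pmf (bernoulli_pmf c) \<Otimes>\<^sub>M \<mu>) (\<lambda>p. 1 / (z - complex_of_real (g p)))"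
      using int unfolding \<rho>_def by (subst (asm) integrable_distr_eq) auto
    have "cauchy_transform \<rho> z = (LINT p|(measure_pmf (bernoulli_pmf c) \<Otimes>\<^sub>M \<mu>). 1 / (z - complex_of_real (g p)))"
      unfolding cauchy_transform_def \<rho>_def by (subst integral_distr) auto
    also have "\<dots> = (LINT b|measure_pmf (bernoulli_pmf c). LINT x|\<mu>. 1 / (z - complex_of_real (g (b, x))))"
      using P.integral_fst'[OF int2] by simp
    also have "\<dots> = (\<Sum>b\<in>UNIV. pmf (bernoulli_pmf c) b *\<^sub>R (LINT x|\<mu>. 1 / (z - complex_of_real (g (b, x)))))"
      by (rule integral_measure_pmf) auto
    also have "\<dots> = c / (z - of_real a) + (1 - c) * cauchy_transform \<mu> z"
      using c by (simp add: UNIV_bool g_def cauchy_transform_def scaleR_conv_of_real M.prob_space)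
    finally show ?thesis .
  qed
  ultimately show ?thesis by blast
qed

lemma integrable_one_over_one_plus_square:
  "integrable lborel (\<lambda>v::real. 1 / (1 + v\<^sup>2))" "(LINT v|lborel. 1 / (1 + v\<^sup>2)) = (pi :: real)"
proof -
  have der: "DERIV arctan x :> 1 / (1 + x\<^sup>2)" for x :: real
    using DERIV_arctan[of x] by (simp add: divide_inverse)
  have cont: "isCont (\<lambda>v::real. 1 / (1 + v\<^sup>2)) x" for x
    by (intro continuous_intros) (auto simp: add_nonneg_eq_0_iff)
  have bot: "((arctan \<circ> real_of_ereal) \<longlongrightarrow> - (pi / 2)) (at_right (- \<infinity>))"
    using tendsto_arctan_at_bot by (simp add: ereal_tendsto_simps)
  have top: "((arctan \<circ> real_of_ereal) \<longlongrightarrow> pi / 2) (at_left \<infinity>)"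
    using tendsto_arctan_at_top by (simp add: ereal_tendsto_simps)
  have nonneg: "AE x in lborel. - \<infinity> < ereal x \<longrightarrow> ereal x < \<infinity> \<longrightarrow> 0 \<le> 1 / (1 + x\<^sup>2)" by simp
  have "(- \<infinity> :: ereal) < \<infinity>" by simp
  note FTC = interval_integral_FTC_nonneg[OF this der cont nonneg bot top]
  have A: "set_integrable lborel (einterval (-\<infinity>) \<infinity>) (\<lambda>v::real. 1 / (1 + v\<^sup>2))"
    by (rule FTC(1))
  have B: "(LBINT v=-\<infinity>..\<infinity>. 1 / (1 + v\<^sup>2)) = pi / 2 - (- (pi / 2))"
    by (rule FTC(2))
  have "einterval (-\<infinity>) \<infinity> = UNIV" by (rule einterval_eq_UNIV)
  with A show "integrable lborel (\<lambda>v::real. 1 / (1 + v\<^sup>2))"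
    by (simp add: set_integrable_def)
  have "(LBINT v=-\<infinity>..\<infinity>. 1 / (1 + v\<^sup>2)) = (LINT v|lborel. 1 / (1 + v\<^sup>2) :: real)"
    unfolding interval_lebesgue_integral_def set_lebesgue_integral_def \<open>einterval (-\<infinity>) \<infinity> = UNIV\<close>
      indicator_UNIV scaleR_one by (rule if_P) simp
  from this B show "(LINT v|lborel. 1 / (1 + v\<^sup>2)) = (pi :: real)"
    unfolding diff_minus_eq_add field_sum_of_halves by (rule trans[OF sym])
qed

text \<open>\<open>\<pi>\<close> times the characteristic function of the standard Cauchy distribution.\<close>

definition cauchy_law_char :: "real \<Rightarrow> complex" where
  "cauchy_law_char s = (LINT v|lborel. iexp (s * v) * of_real (1 / (1 + v\<^sup>2)))"

lemma cauchy_law_char_tendsto: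
  assumes "X \<longlonglongrightarrow> 0"
  shows "(\<lambda>n. cauchy_law_char (X n)) \<longlonglongrightarrow> pi"
proof -
  have "(\<lambda>n. cauchy_law_char (X n)) \<longlonglongrightarrow> (LINT v|lborel. complex_of_real (1 / (1 + v\<^sup>2)))"
    unfolding cauchy_law_char_def
  proof (rule integral_dominated_convergence[where w = "\<lambda>v. 1 / (1 + v\<^sup>2)"])
    show "AE v in lborel. (\<lambda>n. iexp (X n * v) * complex_of_real (1 / (1 + v\<^sup>2))) \<longlonglongrightarrow> complex_of_real (1 / (1 + v\<^sup>2))"
    proof (rule AE_I2)
      fix v
      have "(\<lambda>n. iexp (X n * v) * complex_of_real (1 / (1 + v\<^sup>2))) \<longlonglongrightarrow> iexp (0 * v) * complex_of_real (1 / (1 + v\<^sup>2))"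
        by (intro tendsto_intros assms)
      then show "(\<lambda>n. iexp (X n * v) * complex_of_real (1 / (1 + v\<^sup>2))) \<longlonglongrightarrow> complex_of_real (1 / (1 + v\<^sup>2))" by simp
    qed
  qed (auto simp: integrable_one_over_one_plus_square norm_mult simp del: of_real_divide)
  then show ?thesis unfolding integral_complex_of_real integrable_one_over_one_plus_square(2) .
qed

lemma poisson_kernel_rescale:
  assumes "y > 0"
  shows "y * (y / ((a + y * v - a)\<^sup>2 + y\<^sup>2)) = 1 / (1 + (v::real)\<^sup>2)"
proof -
  have "(a + y * v - a)\<^sup>2 + y\<^sup>2 = y * y * (1 + v\<^sup>2)" by (simp add: power2_eq_square algebra_simps)
  then show ?thesis using assms by simp
qed

lemma integrable_poisson_kernel:
  assumes "y > 0"
  shows "integrable lborel (\<lambda>x. y / ((x - a)\<^sup>2 + y\<^sup>2))" "(LINT x|lborel. y / ((x - a)\<^sup>2 + y\<^sup>2)) = (pi::real)"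
proof -
  have e: "y / ((a + y * v - a)\<^sup>2 + y\<^sup>2) = (1 / y) * (1 / (1 + v\<^sup>2))" for v :: real
    unfolding poisson_kernel_rescale[OF assms, of a v, symmetric] using assms by simp
  have "integrable lborel (\<lambda>v. (1 / y) * (1 / (1 + v\<^sup>2)))"
    by (intro integrable_mult_right integrable_one_over_one_plus_square)
  then have "integrable lborel (\<lambda>v. y / ((a + y * v - a)\<^sup>2 + y\<^sup>2))" unfolding e .
  then show "integrable lborel (\<lambda>x. y / ((x - a)\<^sup>2 + y\<^sup>2))"
    using lborel_integrable_real_affine_iff[of y "\<lambda>x. y / ((x - a)\<^sup>2 + y\<^sup>2)" a] assms by blast
  have "(LINT x|lborel. y / ((x - a)\<^sup>2 + y\<^sup>2)) = \<bar>y\<bar> *\<^sub>R (LINT v|lborel. y / ((a + y * v - a)\<^sup>2 + y\<^sup>2))"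
    using assms by (intro lborel_integral_real_affine) simp
  also have "\<dots> = \<bar>y\<bar> *\<^sub>R ((1 / y) * pi)"
    unfolding e integral_mult_right_zero integrable_one_over_one_plus_square(2) ..
  finally show "(LINT x|lborel. y / ((x - a)\<^sup>2 + y\<^sup>2)) = (pi::real)" using assms by simp
qed

text \<open>The function \<open>- Im (G (x + i y)) / \<pi>\<close> is the density of the convolution of \<open>\<mu>\<close> with the Cauchy
  distribution of scale \<open>y\<close>, so its Fourier transform is the product of the two characteristic
  functions; this is an application of Fubini.\<close>

lemma char_mult_cauchy_law_char:
  assumes \<mu>: "real_prob \<mu>" and y: "y > 0"
  shows "char \<mu> u * cauchy_law_char (u * y) = 
    (LINT x|lborel. iexp (u * x) * of_real (- Im (cauchy_transform \<mu> (Complex x y))))"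
proof -
  interpret M: prob_space \<mu> by (rule real_probD(1)[OF \<mu>])
  interpret P: pair_sigma_finite \<mu> lborel ..
  note [measurable_cong] = real_probD(2)[OF \<mu>]
  define f where "f = (\<lambda>a x. iexp (u * x) * of_real (y / ((x - a)\<^sup>2 + y\<^sup>2)))"
  have f[measurable]: "case_prod f \<in> borel_measurable (\<mu> \<Otimes>\<^sub>M lborel)"
    unfolding f_def by measurable
  have nf: "norm (f a x) = y / ((x - a)\<^sup>2 + y\<^sup>2)" for a x
    unfolding f_def norm_mult norm_of_real using y by simp
  have fint: "integrable lborel (f a)" for a
  proof (rule Bochner_Integration.integrable_bound[OF integrable_poisson_kernel(1)[OF y, of a]])
    show "f a \<in> borel_measurable lborel" unfolding f_def by measurable
    show "AE x in lborel. norm (f a x) \<le> norm (y / ((x - a)\<^sup>2 + y\<^sup>2))"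
      unfolding nf using y by simp
  qed
  have int: "integrable (\<mu> \<Otimes>\<^sub>M lborel) (case_prod f)"
  proof (rule P.Fubini_integrable[OF f])
    show "integrable \<mu> (\<lambda>x. LINT y|lborel. norm (case (x, y) of (a, x) \<Rightarrow> f a x))"
      by (simp add: nf integrable_poisson_kernel(2)[OF y])
    show "AE x in \<mu>. integrable lborel (\<lambda>y. case (x, y) of (a, x) \<Rightarrow> f a x)"
      using fint by simp
  qed
  have inner: "(LINT x|lborel. f a x) = iexp (u * a) * cauchy_law_char (u * y)" for a
  proof -
    have "(LINT x|lborel. f a x) = y *\<^sub>R (LINT v|lborel. f a (a + y * v))"
      using lborel_integral_real_affine[of y "f a" a] y by simp
    also have "\<dots> = (LINT v|lborel. iexp (u * a) * (iexp (u * y * v) * of_real (1 / (1 + v\<^sup>2))))"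
      unfolding integral_scaleR_right[symmetric]
    proof (rule Bochner_Integration.integral_cong[OF refl])
      fix v
      have "y *\<^sub>R f a (a + y * v) = iexp (u * (a + y * v)) * of_real (y * (y / ((a + y * v - a)\<^sup>2 + y\<^sup>2)))"
        by (simp add: f_def scaleR_conv_of_real mult_ac)
      also have "\<dots> = iexp (u * a) * (iexp (u * y * v) * of_real (1 / (1 + v\<^sup>2)))"
        unfolding poisson_kernel_rescale[OF y] by (simp add: exp_add[symmetric] algebra_simps)
      finally show "y *\<^sub>R f a (a + y * v) = iexp (u * a) * (iexp (u * y * v) * of_real (1 / (1 + v\<^sup>2)))" .
    qed
    finally show ?thesis unfolding cauchy_law_char_def integral_mult_right_zero .
  qed
  have "char \<mu> u * cauchy_law_char (u * y) = (LINT a|\<mu>. LINT x|lborel. f a x)"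
    unfolding inner char_def by simp
  also have "\<dots> = (LINT x|lborel. LINT a|\<mu>. f a x)"
    by (rule P.Fubini_integral[OF int, symmetric])
  also have "\<dots> = (LINT x|lborel. iexp (u * x) * of_real (- Im (cauchy_transform \<mu> (Complex x y))))"
  proof (rule Bochner_Integration.integral_cong[OF refl])
    fix x
    have ci: "integrable \<mu> (\<lambda>a. 1 / (Complex x y - complex_of_real a))"
      using y by (intro integrable_cauchy_kernel[OF \<mu>]) simp
    have "Im (1 / (Complex x y - complex_of_real a)) = - (y / ((x - a)\<^sup>2 + y\<^sup>2))" for a
      by (simp add: Im_divide)
    then have "- Im (cauchy_transform \<mu> (Complex x y)) = (LINT a|\<mu>. y / ((x - a)\<^sup>2 + y\<^sup>2))"
      unfolding cauchy_transform_def integral_Im[OF ci, symmetric] by simp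
    then show "(LINT a|\<mu>. f a x) = iexp (u * x) * of_real (- Im (cauchy_transform \<mu> (Complex x y)))"
      unfolding f_def by (simp only: integral_mult_right_zero integral_complex_of_real)
  qed
  finally show ?thesis .
qed

text \<open>As \<open>y \<longlonglongrightarrow> 0\<close> the Cauchy factor in the previous identity tends to \<open>\<pi>\<close>, so the Cauchy transform
  determines the characteristic function.\<close>

lemma cauchy_transform_unique:
  assumes "real_prob \<mu>" "real_prob \<nu>"
    and eq: "\<And>z. Im z > 0 \<Longrightarrow> cauchy_transform \<mu> z = cauchy_transform \<nu> z"
  shows "\<mu> = \<nu>"
proof (rule Levy_uniqueness)
  show "real_distribution \<mu>" "real_distribution \<nu>"
    using assms by (auto simp: real_prob_def real_distribution_def real_distribution_axioms_def)
  show "char \<mu> = char \<nu>"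
  proof
    fix u
    \<comment> \<open>the scale is \<open>y = 1 / (n + 1)\<close>\<close>
    define X where "X = (\<lambda>n::nat. u * (1 / (real n + 1)))"
    have "X \<longlonglongrightarrow> u * 0" unfolding X_def by (intro tendsto_intros) real_asymp
    then have lim: "(\<lambda>n. cauchy_law_char (X n)) \<longlonglongrightarrow> pi" by (simp add: cauchy_law_char_tendsto)
    have "char \<mu> u * cauchy_law_char (X n) = char \<nu> u * cauchy_law_char (X n)" for n
      unfolding X_def using assms by (subst (1 2) char_mult_cauchy_law_char) (auto simp: eq)
    then have "(\<lambda>n. char \<nu> u * cauchy_law_char (X n)) \<longlonglongrightarrow> char \<mu> u * pi"
      using tendsto_mult_left[OF lim, of "char \<mu> u"] by (simp only:)
    moreover have "(\<lambda>n. char \<nu> u * cauchy_law_char (X n)) \<longlonglongrightarrow> char \<nu> u * pi"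
      using tendsto_mult_left[OF lim, of "char \<nu> u"] by simp
    ultimately have "char \<mu> u * pi = char \<nu> u * pi" using LIMSEQ_unique by blast
    then show "char \<mu> u = char \<nu> u" by simp
  qed
qed

section \<open>Measures with transform \<open>- 4 / (r\<^sup>2 + \<sigma> r + m)\<close>\<close>

text \<open>For \<open>m \<ge> 0\<close> the measure is \<open>half_measure\<close>.  For \<open>m < 0\<close> the denominator is
  \<open>(r + p) (r - b)\<close> with \<open>p, b > 0\<close>, so the transform has a pole at \<open>r = b\<close>, that is at the real point
  \<open>z = (t\<^sup>2 - b\<^sup>2) / 4\<close>.  Splitting off this pole leaves a multiple of \<open>- 4 / ((r + p) (r + b))\<close>, the
  transform of an absolutely continuous law; the weights are \<open>b / a\<close> and \<open>1 - b / a\<close> with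
  \<open>a = (p + b) / 2\<close>.  These atoms occur for starting points outside the state space, where a Biane
  kernel must be defined as well.\<close>

lemma exists_half_measure:
  fixes t \<sigma> m :: real
  assumes \<sigma>: "\<sigma> > 0"
  shows "\<exists>\<rho>. real_prob \<rho> \<and> (\<forall>z. Im z > 0 \<longrightarrow> cauchy_transform \<rho> z =
    - 4 / ((csqrt (of_real t ^ 2 - 4 * z))\<^sup>2 + \<sigma> * csqrt (of_real t ^ 2 - 4 * z) + m))"
proof (cases "m \<ge> 0")
  case True
  then show ?thesis
    using real_prob_half_measure[OF \<sigma>] cauchy_transform_half_measure[OF \<sigma>] by metis
next
  case False
  \<comment> \<open>the roots of \<open>X\<^sup>2 + \<sigma> X + m\<close> are \<open>b\<close> and \<open>- p\<close>\<close>
  define a b p where "a = sqrt (\<sigma>\<^sup>2 / 4 - m)" and "b = a - \<sigma> / 2" and "p = a + \<sigma> / 2"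
  have "\<sigma>\<^sup>2 / 4 - m \<ge> 0" using False zero_le_power2[of \<sigma>] by linarith
  then have a2: "a\<^sup>2 = \<sigma>\<^sup>2 / 4 - m" by (simp add: a_def)
  have "a > \<sigma> / 2"
    unfolding a_def using False \<sigma> by (intro real_less_rsqrt) (simp add: power_divide)
  then have b: "b > 0" and a: "a > 0" and p: "p > 0" using \<sigma> by (auto simp: b_def p_def)
  have m: "m = - (p * b)" using a2 by (simp add: b_def p_def algebra_simps power2_eq_square)
  have pb: "p + b = 2 * a" "p - b = \<sigma>" by (simp_all add: b_def p_def)
  have c: "0 \<le> b / a" "b / a \<le> 1" using a b \<sigma> by (auto simp: b_def)
  have prob: "real_prob (half_measure t (p + b) (p * b))"
    using p b by (intro real_prob_half_measure) auto
  obtain \<rho> where \<rho>: "real_prob \<rho>" and G: "\<And>z :: complex. Im z > 0 \<Longrightarrow> cauchy_transform \<rho> z = 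
      (b / a) / (z - of_real ((t\<^sup>2 - b\<^sup>2) / 4)) + (1 - b / a) * cauchy_transform (half_measure t (p + b) (p * b)) z"
    using exists_atom_mixture[OF prob c, of "(t\<^sup>2 - b\<^sup>2) / 4"] by blast
  have "cauchy_transform \<rho> z = - 4 / ((csqrt (of_real t ^ 2 - 4 * z))\<^sup>2 + \<sigma> * csqrt (of_real t ^ 2 - 4 * z) + m)"
    if z: "Im z > 0" for z
  proof -
    define r where "r = csqrt (of_real t ^ 2 - 4 * z)"
    have r: "Re r > 0" "Im r < 0" "r\<^sup>2 = of_real t ^ 2 - 4 * z" using csqrt_upper_half_plane[OF z] by (auto simp: r_def)
    define P B A where "P = complex_of_real p" and "B = complex_of_real b" and "A = complex_of_real a"
    have nz: "P + r \<noteq> 0" "B + r \<noteq> 0" "B - r \<noteq> 0" "A \<noteq> 0"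
      using r(2) a by (auto simp: P_def B_def A_def complex_eq_iff)
    have A: "A = (P + B) / 2" using pb(1) by (simp add: A_def P_def B_def flip: of_real_add)
    have z0: "z - of_real ((t\<^sup>2 - b\<^sup>2) / 4) = (B - r) * (B + r) / 4"
      using r(3) by (simp add: B_def algebra_simps power2_eq_square diff_divide_distrib add_divide_distrib)
    have "cauchy_transform (half_measure t (p + b) (p * b)) z = - 4 / (r\<^sup>2 + of_real (p + b) * r + of_real (p * b))"
      unfolding r_def using p b z by (intro cauchy_transform_half_measure) auto
    also have "r\<^sup>2 + of_real (p + b) * r + of_real (p * b) = (P + r) * (B + r)"
      by (simp add: P_def B_def algebra_simps power2_eq_square)
    finally have H: "cauchy_transform (half_measure t (p + b) (p * b)) z = - 4 / ((P + r) * (B + r))" .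
    have "cauchy_transform \<rho> z = B / A / ((B - r) * (B + r) / 4) + (1 - B / A) * (- 4 / ((P + r) * (B + r)))"
      unfolding G[OF z] z0 H by (simp add: B_def A_def)
    also have "\<dots> = 4 * (B * (P + r) - (A - B) * (B - r)) / (A * ((B - r) * (B + r) * (P + r)))"
      using nz by (simp add: divide_simps) (simp add: algebra_simps)
    also have "B * (P + r) - (A - B) * (B - r) = A * (B + r)"
      unfolding A by (simp add: algebra_simps add_divide_distrib diff_divide_distrib)
    also have "4 * (A * (B + r)) / (A * ((B - r) * (B + r) * (P + r))) = 4 / ((B - r) * (P + r))"
    proof -
      have "4 * (k * x) / (k * (y * x * w)) = 4 / (y * w)" if "k \<noteq> 0" "x \<noteq> 0" for k x y w :: complex
        using that by simp
      then show ?thesis using nz by blast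
    qed
    also have "\<dots> = - 4 / ((r - B) * (P + r))"
      using nz by (simp add: divide_simps)
    also have "(r - B) * (P + r) = r\<^sup>2 + \<sigma> * r + m"
      unfolding m pb(2)[symmetric] by (simp add: P_def B_def algebra_simps power2_eq_square)
    finally show ?thesis unfolding r_def .
  qed
  then show ?thesis using \<rho> by blast
qed

section \<open>The free half-stable semigroup\<close>

text \<open>The quartic \<open>(m - S\<^sup>2)\<^sup>2 + \<sigma>\<^sup>2 S\<^sup>2\<close> at the parameters of the kernel is sixteen times the quadratic
  polynomial in the denominator of \<open>f_half\<close>.\<close>

lemma half_density_eq_f_half:
  assumes "s < t"
  shows "half_density t (2 * (t - s)) ((t - s)\<^sup>2 - s\<^sup>2 + 4 * x) y = f_half s t x y * indicator {t\<^sup>2 / 4<..} y"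
proof (cases "y > t\<^sup>2 / 4")
  case True
  define S D where "S = sqrt (4 * y - t\<^sup>2)" and "D = (y - x)\<^sup>2 - (t - s) * (s * y - t * x)"
  have S2: "S\<^sup>2 = 4 * y - t\<^sup>2" using True by (simp add: S_def)
  have "((t - s)\<^sup>2 - s\<^sup>2 + 4 * x - S\<^sup>2)\<^sup>2 + (2 * (t - s))\<^sup>2 * S\<^sup>2 = 16 * D"
    unfolding S2 D_def by (simp add: algebra_simps power2_eq_square)
  then have "half_density t (2 * (t - s)) ((t - s)\<^sup>2 - s\<^sup>2 + 4 * x) y = 4 * (2 * (t - s)) / pi * (S / (16 * D))"
    using True unfolding half_density_def S_def[symmetric] by simp
  also have "\<dots> = (t - s) * S / (2 * pi * D)" by (cases "D = 0") (simp_all add: field_simps)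
  finally show ?thesis using True unfolding f_half_def S_def D_def by simp
qed (simp add: half_density_def)

lemma P_half_eq_half_measure:
  "s < t \<Longrightarrow> P_half s t x = half_measure t (2 * (t - s)) ((t - s)\<^sup>2 - s\<^sup>2 + 4 * x)"
  unfolding P_half_def half_measure_def half_density_eq_f_half ..

lemma nu_half_eq_P_half: "t > 0 \<Longrightarrow> nu_half t = P_half 0 t 0"
  unfolding nu_half_def P_half_def f_half_def by simp

lemma nu_half_eq_half_measure: "t > 0 \<Longrightarrow> nu_half t = half_measure t (2 * t) (t\<^sup>2)"
  by (simp add: nu_half_eq_P_half P_half_eq_half_measure)

lemma real_prob_nu_half:
  assumes "t \<ge> 0"
  shows "real_prob (nu_half t)"
proof (cases "t = 0")
  case True
  then show ?thesis by (auto simp: nu_half_def real_prob_def intro: prob_space_return)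
next
  case False
  then show ?thesis using assms by (simp add: nu_half_eq_half_measure real_prob_half_measure)
qed

lemma cauchy_transform_nu_half:
  assumes t: "t \<ge> 0" and z: "Im z > 0"
  shows "cauchy_transform (nu_half t) z = - 4 / (of_real t + csqrt (of_real t ^ 2 - 4 * z))\<^sup>2"
proof (cases "t = 0")
  case True
  have "cauchy_transform (nu_half 0) z = 1 / z"
    unfolding cauchy_transform_def nu_half_def by (simp add: integral_return)
  then show ?thesis using True by simp
next
  case False
  define r where "r = csqrt (of_real t ^ 2 - 4 * z)"
  have "t > 0" using False t by simp
  then have "cauchy_transform (nu_half t) z = - 4 / (r\<^sup>2 + of_real (2 * t) * r + of_real (t\<^sup>2))"
    unfolding r_def nu_half_eq_half_measure[OF \<open>t > 0\<close>] using z
    by (intro cauchy_transform_half_measure) auto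
  also have "r\<^sup>2 + of_real (2 * t) * r + of_real (t\<^sup>2) = (of_real t + r)\<^sup>2"
    by (simp add: power2_eq_square algebra_simps)
  finally show ?thesis unfolding r_def .
qed

text \<open>Solving \<open>w = - 4 / (t + r)\<^sup>2\<close> for \<open>r\<close> and then \<open>r\<^sup>2 = t\<^sup>2 - 4 z\<close> for \<open>z\<close> gives
  \<open>z = 1 / w + t csqrt (- 1 / w)\<close>, which makes the \<open>R\<close>-transform linear in \<open>t\<close>.  The point to check
  is that \<open>r = 2 csqrt (- 1 / w) - t\<close> is the principal root.  With
  \<open>csqrt (- 1 / w) = a - i c\<close>, the cone condition at aperture \<open>1 / 2\<close> reads \<open>\<bar>a\<^sup>2 - c\<^sup>2\<bar> < a c\<close>, hence
  \<open>c < 2 a\<close>, and then \<open>t\<^sup>2 < \<beta> < 2 a c < (2 a)\<^sup>2\<close> gives \<open>Re r > 0\<close>.\<close>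

lemma nu_half_R_transform:
  assumes t: "t \<ge> 0" and \<beta>: "\<beta> > t\<^sup>2"
  shows "is_R_transform (nu_half t) (R_domain (1/2) \<beta>) (\<lambda>w. of_real t * csqrt (- (1 / w)))"
  unfolding is_R_transform_def
proof (intro exI[of _ "\<lambda>w. 1 / w + of_real t * csqrt (- (1 / w))"] conjI)
  let ?D = "R_domain (1/2) \<beta>"
  have \<beta>0: "\<beta> > 0" using \<beta> by (meson le_less_trans zero_le_power2)
  have nz: "w \<noteq> 0" if "w \<in> ?D" for w using that \<beta>0 by (auto simp: R_domain_def)
  have holo: "(\<lambda>w. 1 / w + of_real t * csqrt (- (1 / w))) holomorphic_on ?D"
  proof (intro holomorphic_intros)
    fix w assume w: "w \<in> ?D"
    then show "w \<noteq> 0" "w \<noteq> 0" using nz by auto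
    show "- (1 / w) \<notin> \<real>\<^sub>\<le>\<^sub>0"
      using w \<beta>0 by (auto simp: R_domain_def complex_nonpos_Reals_iff)
  qed
  have val: "Im (1 / w + of_real t * csqrt (- (1 / w))) > 0 \<and>
      cauchy_transform (nu_half t) (1 / w + of_real t * csqrt (- (1 / w))) = w" if w: "w \<in> ?D" for w
  proof -
    define v q where "v = 1 / w" and "q = csqrt (- v)"
    have v: "Im v > \<beta>" "\<bar>Re v\<bar> < Im v / 2" using w by (auto simp: R_domain_def v_def)
    have q2: "q\<^sup>2 = - v" unfolding q_def by (rule power2_csqrt)
    define a c where "a = Re q" and "c = - Im q"
    have re: "a\<^sup>2 - c\<^sup>2 = - Re v" and im: "2 * a * c = Im v"
      using arg_cong[OF q2, of Re] arg_cong[OF q2, of Im] by (auto simp: a_def c_def power2_eq_square mult_ac)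
    have "a \<ge> 0" unfolding a_def q_def by (rule Re_csqrt)
    moreover have "a * c > 0" using im v(1) \<beta>0 by linarith
    ultimately have ac: "a > 0" "c > 0" by (auto simp: zero_less_mult_iff)
    \<comment> \<open>If \<open>c \<ge> 2 a\<close> then \<open>c\<^sup>2 - a c = c (c - a) \<ge> 2 a\<^sup>2\<close>, against \<open>c\<^sup>2 - a\<^sup>2 < a c\<close>.\<close>
    have "c < 2 * a"
    proof (rule ccontr)
      assume "\<not> c < 2 * a"
      then have "c - a \<ge> a" "c \<ge> a" using ac by auto
      then have "c * (c - a) \<ge> a * a" using ac by (intro mult_mono) auto
      moreover have "c\<^sup>2 - a\<^sup>2 < a * c" using re im v(2) by linarith
      ultimately show False by (simp add: power2_eq_square algebra_simps)
    qed
    then have "2 * a * c < 2 * a * (2 * a)" using ac by (intro mult_strict_left_mono) auto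
    then have "t\<^sup>2 < (2 * a)\<^sup>2" using im v(1) \<beta> by (simp add: power2_eq_square)
    then have ta: "t < 2 * a" by (rule power2_less_imp_less) (use ac in simp)
    define z where "z = v + of_real t * q"
    have "Im z = c * (2 * a - t)" by (simp add: z_def im[symmetric] c_def algebra_simps)
    then have Imz: "Im z > 0" using ac ta by simp
    have cs: "csqrt (of_real t ^ 2 - 4 * z) = 2 * q - of_real t"
    proof (rule csqrt_unique)
      have "v = - q\<^sup>2" using q2 by simp
      then show "(2 * q - of_real t)\<^sup>2 = of_real t ^ 2 - 4 * z"
        by (simp add: z_def power2_eq_square algebra_simps)
      show "0 < Re (2 * q - of_real t) \<or> Re (2 * q - of_real t) = 0 \<and> 0 \<le> Im (2 * q - of_real t)"
        using ta by (simp add: a_def)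
    qed
    have "cauchy_transform (nu_half t) z = - 4 / (2 * q)\<^sup>2"
      unfolding cauchy_transform_nu_half[OF t Imz] cs by simp
    also have "\<dots> = w" using nz[OF w] q2 by (simp add: power_mult_distrib v_def)
    finally show ?thesis using Imz unfolding z_def q_def v_def by simp
  qed
  have lim: "((\<lambda>w. w * (1 / w + of_real t * csqrt (- (1 / w)))) \<longlongrightarrow> 1) (at 0 within ?D)"
  proof -
    have "((\<lambda>w. of_real t * (w * csqrt (- (1 / w)))) \<longlongrightarrow> 0) (at 0 within ?D)"
    proof (rule Lim_null_comparison[where g = "\<lambda>w. \<bar>t\<bar> * sqrt (norm w)"])
      show "\<forall>\<^sub>F w in at 0 within ?D. norm (of_real t * (w * csqrt (- (1 / w)))) \<le> \<bar>t\<bar> * sqrt (norm w)"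
        unfolding eventually_at_filter
      proof (intro always_eventually allI impI)
        fix w :: complex assume "w \<noteq> 0"
        then have "norm w * sqrt (1 / norm w) = sqrt (norm w)"
          by (simp add: real_sqrt_divide real_div_sqrt)
        then show "norm (of_real t * (w * csqrt (- (1 / w)))) \<le> \<bar>t\<bar> * sqrt (norm w)"
          by (simp add: norm_mult norm_divide)
      qed
      have "((\<lambda>w::complex. \<bar>t\<bar> * sqrt (norm w)) \<longlongrightarrow> \<bar>t\<bar> * sqrt (norm (0::complex))) (at 0 within ?D)"
        by (intro tendsto_intros)
      then show "((\<lambda>w. \<bar>t\<bar> * sqrt (norm w)) \<longlongrightarrow> 0) (at (0::complex) within ?D)" by simp
    qed
    then have "((\<lambda>w. 1 + of_real t * (w * csqrt (- (1 / w)))) \<longlongrightarrow> 1 + 0) (at 0 within ?D)"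
      by (intro tendsto_intros)
    moreover have "\<forall>\<^sub>F w in at 0 within ?D. 1 + of_real t * (w * csqrt (- (1 / w))) = w * (1 / w + of_real t * csqrt (- (1 / w)))"
      unfolding eventually_at_filter by (intro always_eventually) (auto simp: field_simps)
    ultimately show ?thesis using Lim_transform_eventually by fastforce
  qed
  show "is_cauchy_inverse (nu_half t) ?D (\<lambda>w. 1 / w + of_real t * csqrt (- (1 / w)))"
    unfolding is_cauchy_inverse_def using holo val lim by blast
qed auto

lemma free_convolution_semigroup_nu_half: "free_convolution_semigroup nu_half"
  unfolding free_convolution_semigroup_def
proof (intro conjI allI impI)
  fix s t :: real assume st: "s \<ge> 0" "t \<ge> 0"
  define \<beta> where "\<beta> = (t + s)\<^sup>2 + 1"
  have \<beta>: "\<beta> > 0" "\<beta> > t\<^sup>2" "\<beta> > s\<^sup>2" "\<beta> > (t + s)\<^sup>2"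
  proof -
    have "t\<^sup>2 \<le> (t + s)\<^sup>2" "s\<^sup>2 \<le> (t + s)\<^sup>2" using st by (auto intro!: power_mono)
    then show "\<beta> > t\<^sup>2" "\<beta> > s\<^sup>2" by (simp_all add: \<beta>_def)
  qed (simp_all add: \<beta>_def add_nonneg_pos)
  have "is_R_transform (nu_half (t + s)) (R_domain (1/2) \<beta>) (\<lambda>w. of_real t * csqrt (- (1 / w)) + of_real s * csqrt (- (1 / w)))"
    using nu_half_R_transform[of "t + s" \<beta>] st \<beta> by (simp add: distrib_right)
  then show "is_free_convolution (nu_half t) (nu_half s) (nu_half (t + s))"
    unfolding is_free_convolution_def
    using st \<beta> real_prob_nu_half nu_half_R_transform[of t \<beta>] nu_half_R_transform[of s \<beta>]
    by (intro conjI exI[of _ "1/2"] exI[of _ \<beta>] exI[of _ "\<lambda>w. of_real t * csqrt (- (1 / w))"]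
        exI[of _ "\<lambda>w. of_real s * csqrt (- (1 / w))"]) auto
next
  show "nu_half 0 = return borel 0" by (simp add: nu_half_def)
qed (rule real_prob_nu_half)

section \<open>Subordination functions and Biane kernels\<close>

text \<open>The solution \<open>F\<close> of \<open>s + csqrt (s\<^sup>2 - 4 F) = t + csqrt (t\<^sup>2 - 4 z)\<close>, for \<open>s < t\<close> and \<open>z\<close>
  in the upper half plane.\<close>

definition half_subordinator :: "real \<Rightarrow> real \<Rightarrow> complex \<Rightarrow> complex" where
  "half_subordinator s t z = z - of_real ((t - s) / 2) * (of_real t + csqrt (of_real t ^ 2 - 4 * z))"

lemma half_subordinator_Im:
  assumes "s < t" "Im z > 0"
  shows "Im (half_subordinator s t z) > 0" "Im (half_subordinator s t z) \<ge> Im z"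
proof -
  have "Im (half_subordinator s t z) = Im z + (t - s) / 2 * (- Im (csqrt (of_real t ^ 2 - 4 * z)))"
    by (simp add: half_subordinator_def flip: of_real_divide of_real_diff)
  moreover have "(t - s) / 2 * (- Im (csqrt (of_real t ^ 2 - 4 * z))) \<ge> 0"
    using assms csqrt_upper_half_plane(2)[OF assms(2), of t] by (intro mult_nonneg_nonneg) auto
  ultimately show "Im (half_subordinator s t z) \<ge> Im z" by linarith
  then show "Im (half_subordinator s t z) > 0" using assms(2) by linarith
qed

lemma half_subordinator_csqrt:
  assumes "s < t" "Im z > 0"
  shows "csqrt (of_real s ^ 2 - 4 * half_subordinator s t z) = of_real (t - s) + csqrt (of_real t ^ 2 - 4 * z)"
proof (rule csqrt_unique)
  define r where "r = csqrt (of_real t ^ 2 - 4 * z)"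
  have r: "Re r > 0" "4 * z = of_real t ^ 2 - r\<^sup>2" using csqrt_upper_half_plane[OF assms(2)] by (auto simp: r_def)
  have "4 * half_subordinator s t z = 4 * z - 2 * of_real (t - s) * (of_real t + r)"
    by (simp add: half_subordinator_def r_def field_simps)
  then have hs: "4 * half_subordinator s t z = of_real t ^ 2 - r\<^sup>2 - 2 * of_real (t - s) * (of_real t + r)"
    unfolding r(2) .
  show "(of_real (t - s) + csqrt (of_real t ^ 2 - 4 * z))\<^sup>2 = of_real s ^ 2 - 4 * half_subordinator s t z"
    unfolding hs r_def[symmetric] by (simp add: power2_eq_square algebra_simps)
  show "0 < Re (of_real (t - s) + csqrt (of_real t ^ 2 - 4 * z)) \<or> 
      Re (of_real (t - s) + csqrt (of_real t ^ 2 - 4 * z)) = 0 \<and> 0 \<le> Im (of_real (t - s) + csqrt (of_real t ^ 2 - 4 * z))"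
    using assms r unfolding r_def[symmetric] by simp
qed

text \<open>By \<open>half_subordinator_csqrt\<close>, \<open>4 F - 4 x = s\<^sup>2 - 4 x - (t - s + r)\<^sup>2\<close>, a quadratic polynomial in \<open>r\<close>.\<close>

lemma half_subordinator_diff:
  assumes "s < t" "Im z > 0"
  shows "half_subordinator s t z - of_real x =
     - ((csqrt (of_real t ^ 2 - 4 * z))\<^sup>2 + of_real (2 * (t - s)) * csqrt (of_real t ^ 2 - 4 * z)
        + of_real ((t - s)\<^sup>2 - s\<^sup>2 + 4 * x)) / 4"
proof -
  define r where "r = csqrt (of_real t ^ 2 - 4 * z)"
  have "(csqrt (of_real s ^ 2 - 4 * half_subordinator s t z))\<^sup>2 = of_real s ^ 2 - 4 * half_subordinator s t z"
    by (rule power2_csqrt)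
  then have "4 * half_subordinator s t z = of_real s ^ 2 - (of_real (t - s) + r)\<^sup>2"
    unfolding half_subordinator_csqrt[OF assms] r_def[symmetric] by simp
  then have "half_subordinator s t z = (of_real s ^ 2 - (of_real (t - s) + r)\<^sup>2) / 4"
    by (auto simp: eq_divide_eq mult.commute)
  then show ?thesis unfolding r_def[symmetric] by (simp add: field_simps power2_eq_square)
qed

lemma biane_subordinator_nu_half:
  assumes st: "0 \<le> s" "s < t"
  shows "biane_subordinator nu_half s t (half_subordinator s t)"
  unfolding biane_subordinator_def
proof (intro conjI allI impI)
  have nonreal: "of_real t ^ 2 - 4 * z \<notin> \<real>\<^sub>\<le>\<^sub>0" if "z \<notin> \<real>" for z :: complex
    using that by (auto simp: complex_nonpos_Reals_iff complex_is_Real_iff simp flip: of_real_power)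
  show "half_subordinator s t holomorphic_on - \<real>"
    unfolding half_subordinator_def by (intro holomorphic_intros) (use nonreal in auto)
  show "half_subordinator s t (cnj z) = cnj (half_subordinator s t z)" if "z \<notin> \<real>" for z
    using cnj_csqrt[OF nonreal[OF that]] by (simp add: half_subordinator_def)
  show "cauchy_transform (nu_half t) z = cauchy_transform (nu_half s) (half_subordinator s t z)" if z: "Im z > 0" for z
    using st z half_subordinator_Im[OF st(2) z]
    by (subst (1 2) cauchy_transform_nu_half) (auto simp: half_subordinator_csqrt)
  show "Im (half_subordinator s t z) > 0" "Im (half_subordinator s t z) \<ge> Im z" if "Im z > 0" for z
    using half_subordinator_Im[OF st(2) that] by auto
  show "((\<lambda>y. half_subordinator s t (\<i> * of_real y) / (\<i> * of_real y)) \<longlongrightarrow> 1) at_top"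
  proof -
    define E where "E = (\<lambda>y. of_real ((t - s) / 2) * (of_real t + csqrt (of_real t ^ 2 - 4 * (\<i> * of_real y))) / (\<i> * of_real y))"
    have "(E \<longlongrightarrow> 0) at_top"
    proof (rule Lim_null_comparison[where g = "\<lambda>y. (t - s) / 2 * (t + sqrt (t\<^sup>2 + 4 * y)) / y"])
      show "\<forall>\<^sub>F y in at_top. norm (E y) \<le> (t - s) / 2 * (t + sqrt (t\<^sup>2 + 4 * y)) / y"
        using eventually_gt_at_top[of 0]
      proof eventually_elim
        case (elim y)
        have "norm (complex_of_real t ^ 2 - 4 * (\<i> * of_real y)) \<le> t\<^sup>2 + 4 * y"
          using norm_triangle_ineq4[of "complex_of_real t ^ 2" "4 * (\<i> * of_real y)"] elim
          by (simp add: norm_mult norm_power)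
        then have "norm (of_real t + csqrt (of_real t ^ 2 - 4 * (\<i> * of_real y))) \<le> t + sqrt (t\<^sup>2 + 4 * y)"
          using st by (intro order.trans[OF norm_triangle_ineq] add_mono) auto
        then show ?case using elim st
          unfolding E_def norm_divide norm_mult norm_of_real
          by (intro divide_right_mono mult_mono frac_le) (auto simp del: of_real_diff)
      qed
      show "((\<lambda>y. (t - s) / 2 * (t + sqrt (t\<^sup>2 + 4 * y)) / y) \<longlongrightarrow> 0) at_top" by real_asymp
    qed
    then have "((\<lambda>y. 1 - E y) \<longlongrightarrow> 1 - 0) at_top" by (intro tendsto_intros)
    moreover have "\<forall>\<^sub>F y in at_top. 1 - E y = half_subordinator s t (\<i> * of_real y) / (\<i> * of_real y)"
      using eventually_gt_at_top[of 0]
      by eventually_elim (auto simp: E_def half_subordinator_def diff_divide_distrib)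
    ultimately show ?thesis using Lim_transform_eventually by fastforce
  qed
qed

text \<open>The transform \<open>- 4 / (s + csqrt (s\<^sup>2 - 4 z))\<^sup>2\<close> is injective on the upper half plane, because
  \<open>s + csqrt (s\<^sup>2 - 4 z)\<close> has positive real part and is therefore determined by its square.\<close>

lemma biane_subordinator_nu_half_unique:
  assumes st: "0 \<le> s" "s < t" and F: "biane_subordinator nu_half s t F" and z: "Im z > 0"
  shows "F z = half_subordinator s t z"
proof -
  define F' where "F' = half_subordinator s t z"
  have ImF: "Im (F z) > 0" using F z by (auto simp: biane_subordinator_def)
  have ImF': "Im F' > 0" unfolding F'_def using half_subordinator_Im[OF st(2) z] by auto
  have "cauchy_transform (nu_half s) (F z) = cauchy_transform (nu_half s) F'"
    using F biane_subordinator_nu_half[OF st] z unfolding biane_subordinator_def F'_def by metis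
  then have eq: "- 4 / (of_real s + csqrt (of_real s ^ 2 - 4 * F z))\<^sup>2 = - 4 / (of_real s + csqrt (of_real s ^ 2 - 4 * F'))\<^sup>2"
    using cauchy_transform_nu_half[OF st(1) ImF] cauchy_transform_nu_half[OF st(1) ImF'] by simp
  define u v where "u = of_real s + csqrt (of_real s ^ 2 - 4 * F z)" and "v = of_real s + csqrt (of_real s ^ 2 - 4 * F')"
  have pos: "Re u > 0" "Re v > 0"
    using csqrt_upper_half_plane(1)[OF ImF, of s] csqrt_upper_half_plane(1)[OF ImF', of s] st
    unfolding u_def v_def plus_complex.simps Re_complex_of_real by linarith+
  have "u\<^sup>2 = v\<^sup>2"
  proof -
    have "u \<noteq> 0" "v \<noteq> 0" using pos by auto
    then show ?thesis using eq unfolding u_def[symmetric] v_def[symmetric] by (simp add: divide_simps)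
  qed
  then have "u = v \<or> u = - v" by (simp add: power2_eq_iff)
  then have "u = v" using pos by auto
  then have "csqrt (of_real s ^ 2 - 4 * F z) = csqrt (of_real s ^ 2 - 4 * F')" by (simp add: u_def v_def)
  then have "of_real s ^ 2 - 4 * F z = of_real s ^ 2 - 4 * F'" by (metis power2_csqrt)
  then show ?thesis by (simp add: F'_def)
qed

lemma states_half_nonneg_param:
  assumes "s < t" "y \<in> states_half s" 
  shows "(t - s)\<^sup>2 - s\<^sup>2 + 4 * y \<ge> 0"
proof -
  have "4 * y \<ge> s\<^sup>2" using assms(2) by (auto simp: states_half_def)
  then show ?thesis using zero_le_power2[of "t - s"] by linarith
qed

lemma inverse_half_subordinator_diff:
  assumes "s < t" "Im z > 0"
  shows "1 / (half_subordinator s t z - of_real x) = 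
     - 4 / ((csqrt (of_real t ^ 2 - 4 * z))\<^sup>2 + of_real (2 * (t - s)) * csqrt (of_real t ^ 2 - 4 * z)
        + of_real ((t - s)\<^sup>2 - s\<^sup>2 + 4 * x))"
proof -
  have "1 / (- D / 4) = - 4 / D" for D :: complex by simp
  then show ?thesis unfolding half_subordinator_diff[OF assms] .
qed

lemma biane_kernel_nu_half_iff:
  assumes st: "0 \<le> s" "s < t"
  shows "biane_kernel nu_half s t Q \<longleftrightarrow> (\<forall>x. real_prob (Q x) \<and>
           (\<forall>z. Im z > 0 \<longrightarrow> cauchy_transform (Q x) z = 1 / (half_subordinator s t z - of_real x)))"
  unfolding biane_kernel_def
  using biane_subordinator_nu_half[OF st] biane_subordinator_nu_half_unique[OF st] by metis

lemma biane_kernel_nu_half_unique: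
  assumes st: "0 \<le> s" "s < t"
  shows "\<exists>!Q. biane_kernel nu_half s t Q"
proof -
  have "\<exists>\<rho>. real_prob \<rho> \<and> (\<forall>z. Im z > 0 \<longrightarrow> cauchy_transform \<rho> z = 1 / (half_subordinator s t z - of_real x))" for x
    using exists_half_measure[of "2 * (t - s)" t "(t - s)\<^sup>2 - s\<^sup>2 + 4 * x"] st
    by (simp only: inverse_half_subordinator_diff[OF st(2)] cong: imp_cong) simp
  then obtain Q where "biane_kernel nu_half s t Q"
    unfolding biane_kernel_nu_half_iff[OF st] by metis
  moreover have "Q1 = Q2" if "biane_kernel nu_half s t Q1" "biane_kernel nu_half s t Q2" for Q1 Q2
    using that unfolding biane_kernel_nu_half_iff[OF st] 
    by (intro ext cauchy_transform_unique) auto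
  ultimately show ?thesis by blast
qed

lemma biane_kernel_nu_half_eq_P_half:
  assumes st: "0 \<le> s" "s < t" and Q: "biane_kernel nu_half s t Q" and y: "y \<in> states_half s"
  shows "Q y = P_half s t y"
proof (rule cauchy_transform_unique)
  have \<sigma>: "2 * (t - s) > 0" using st by simp
  note m = states_half_nonneg_param[OF st(2) y]
  show "real_prob (Q y)" using Q unfolding biane_kernel_nu_half_iff[OF st] by auto
  show "real_prob (P_half s t y)"
    unfolding P_half_eq_half_measure[OF st(2)] by (rule real_prob_half_measure[OF \<sigma> m])
  show "cauchy_transform (Q y) z = cauchy_transform (P_half s t y) z" if z: "Im z > 0" for z
    using Q z unfolding biane_kernel_nu_half_iff[OF st] P_half_eq_half_measure[OF st(2)]
      cauchy_transform_half_measure[OF \<sigma> m z] inverse_half_subordinator_diff[OF st(2) z, symmetric]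
    by simp
qed

section \<open>Laws of Markov processes\<close>

lemma natural_filtration_subalgebra:
  assumes "\<And>t. t \<ge> 0 \<Longrightarrow> Z t \<in> borel_measurable M"
  shows "subalgebra M (natural_filtration M Z s)"
proof -
  have "{Z r -` B \<inter> space M | r B. 0 \<le> r \<and> r \<le> s \<and> B \<in> sets borel} \<subseteq> sets M"
    using assms by (auto intro: measurable_sets)
  then show ?thesis
    unfolding subalgebra_def natural_filtration_def
    by (auto simp: space_measure_of_conv sets_measure_of_conv intro!: sets.sigma_sets_subset)
qed

lemma measurable_natural_filtration:
  assumes "0 \<le> r" "r \<le> s"
  shows "Z r \<in> borel_measurable (natural_filtration M Z s)"
proof (rule measurableI)
  fix B :: "real set" assume B: "B \<in> sets borel"
  let ?G = "{Z r -` B \<inter> space M | r B. 0 \<le> r \<and> r \<le> s \<and> B \<in> sets borel}"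
  have G: "?G \<subseteq> Pow (space M)" by auto
  have "Z r -` B \<inter> space M \<in> sigma_sets (space M) ?G"
    using assms B by (intro sigma_sets.Basic) blast
  then show "Z r -` B \<inter> space (natural_filtration M Z s) \<in> sets (natural_filtration M Z s)"
    unfolding natural_filtration_def space_measure_of[OF G] sets_measure_of[OF G] .
qed simp

text \<open>The density is jointly measurable in the starting point and the end point, so the kernel is
  measurable in the starting point at all real arguments.\<close>

lemma measurable_P_half [measurable]:
  assumes B[measurable]: "B \<in> sets borel"
  shows "(\<lambda>x. measure (P_half s t x) B) \<in> borel_measurable borel"
proof -
  have "measure (P_half s t x) B = enn2real (\<integral>\<^sup>+ y. ennreal (f_half s t x y * indicator {t\<^sup>2 / 4<..} y) * indicator B y \<partial>lborel)" for x
    unfolding P_half_def measure_def f_half_def by (subst emeasure_density) auto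
  moreover have "(\<lambda>x. enn2real (\<integral>\<^sup>+ y. ennreal (f_half s t x y * indicator {t\<^sup>2 / 4<..} y) * indicator B y \<partial>lborel)) \<in> borel_measurable borel"
    unfolding f_half_def by measurable
  ultimately show ?thesis by simp
qed

text \<open>The Markov property integrated over an event of the past.  The kernel enters through an almost
  everywhere equal function \<open>h\<close> because it need not depend measurably on the starting point.\<close>

lemma markov_process_transition:
  assumes Z: "markov_process M Z x0 E P" and st: "0 \<le> s" "s < t"
    and A: "A \<in> sets (natural_filtration M Z s)" and B: "B \<in> sets borel"
    and h: "h \<in> borel_measurable M" "AE \<omega> in M. measure (P s t (Z s \<omega>)) B = h \<omega>"
  shows "measure M (A \<inter> (Z t -` B \<inter> space M)) = (LINT \<omega>|M. indicator A \<omega> * h \<omega>)"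
proof -
  interpret prob_space M using Z by (simp add: markov_process_def)
  have meas: "Z r \<in> borel_measurable M" if "r \<ge> 0" for r
    using Z that by (simp add: markov_process_def)
  have sub: "subalgebra M (natural_filtration M Z s)"
    by (rule natural_filtration_subalgebra) (use meas in auto)
  interpret finite_measure_subalgebra M "natural_filtration M Z s"
    by unfold_locales (rule sub)
  define e where "e = Z t -` B \<inter> space M"
  have e[measurable]: "e \<in> sets M" unfolding e_def using B meas[of t] st by (auto intro: measurable_sets)
  have A'[measurable]: "A \<in> sets M" using A sub by (auto simp: subalgebra_def)
  have ind: "indicat_real A \<omega> * indicat_real e \<omega> = indicat_real (A \<inter> e) \<omega>" for \<omega>
    by (simp add: indicator_def)
  have "measure M (A \<inter> e) = (LINT \<omega>|M. indicator A \<omega> * indicator e \<omega>)"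
    unfolding ind by simp
  also have "\<dots> = (LINT \<omega>|M. indicator A \<omega> * real_cond_exp M (natural_filtration M Z s) (indicator e) \<omega>)"
  proof (rule real_cond_exp_intg(2)[symmetric])
    show "integrable M (\<lambda>\<omega>. indicat_real A \<omega> * indicat_real e \<omega>)"
      unfolding ind by (simp add: emeasure_eq_measure)
  qed (use A in auto)
  also have "\<dots> = (LINT \<omega>|M. indicator A \<omega> * h \<omega>)"
  proof (rule integral_cong_AE)
    have "real_cond_exp M (natural_filtration M Z s) (indicat_real e) \<in> borel_measurable M" by simp
    then show "(\<lambda>\<omega>. indicator A \<omega> * real_cond_exp M (natural_filtration M Z s) (indicator e) \<omega>) \<in> borel_measurable M"
      by measurable
    show "(\<lambda>\<omega>. indicator A \<omega> * h \<omega>) \<in> borel_measurable M" using h(1) by measurable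
    have "AE \<omega> in M. real_cond_exp M (natural_filtration M Z s) (indicator e) \<omega> = measure (P s t (Z s \<omega>)) B"
      using Z st B unfolding markov_process_def e_def by blast
    then show "AE \<omega> in M. indicator A \<omega> * real_cond_exp M (natural_filtration M Z s) (indicator e) \<omega> = indicator A \<omega> * h \<omega>"
      using h(2) by eventually_elim simp
  qed
  finally show ?thesis unfolding e_def .
qed

lemma markov_process_marginal:
  assumes Z: "markov_process M Z x0 E P" and t: "t > 0" and B: "B \<in> sets borel"
  shows "measure M (Z t -` B \<inter> space M) = measure (P 0 t x0) B"
proof -
  interpret prob_space M using Z by (simp add: markov_process_def)
  have "space M \<in> sets (natural_filtration M Z 0)"
    using sets.top[of "natural_filtration M Z 0"] by (simp add: natural_filtration_def space_measure_of_conv)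
  moreover have "AE \<omega> in M. measure (P 0 t (Z 0 \<omega>)) B = measure (P 0 t x0) B"
    using Z by (auto simp: markov_process_def)
  ultimately have "measure M (space M \<inter> (Z t -` B \<inter> space M)) = (LINT \<omega>|M. indicator (space M) \<omega> * measure (P 0 t x0) B)"
    using t B by (intro markov_process_transition[OF Z]) auto
  also have "\<dots> = measure (P 0 t x0) B" by (simp add: prob_space)
  finally show ?thesis by (simp add: Int_absorb1)
qed

lemma markov_process_initial:
  assumes Z: "markov_process M Z x0 E P" and B: "B \<in> sets borel"
  shows "measure M (Z 0 -` B \<inter> space M) = indicator B x0"
proof -
  interpret prob_space M using Z by (simp add: markov_process_def)
  have e: "Z 0 -` B \<inter> space M \<in> sets M"
    using Z B by (auto simp: markov_process_def intro: measurable_sets)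
  have ae: "AE \<omega> in M. Z 0 \<omega> = x0" using Z by (simp add: markov_process_def)
  show ?thesis
  proof (cases "x0 \<in> B")
    case True
    have "AE \<omega> in M. \<omega> \<in> Z 0 -` B \<inter> space M" using ae AE_space by eventually_elim (use True in simp)
    then show ?thesis using True e prob_eq_1 by simp
  next
    case False
    have "AE \<omega> in M. \<omega> \<notin> Z 0 -` B \<inter> space M" using ae by eventually_elim (use False in simp)
    then show ?thesis using False e prob_eq_0 by simp
  qed
qed

definition cylinder :: "'a measure \<Rightarrow> (real \<Rightarrow> 'a \<Rightarrow> real) \<Rightarrow> real set \<Rightarrow> (real \<Rightarrow> real set) \<Rightarrow> 'a set" where
  "cylinder M Z J B = {\<omega> \<in> space M. \<forall>j\<in>J. Z j \<omega> \<in> B j}"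

lemma cylinder_in_natural_filtration:
  assumes "finite J" "J \<noteq> {}" "\<And>j. j \<in> J \<Longrightarrow> 0 \<le> j \<and> j \<le> s" "\<And>j. j \<in> J \<Longrightarrow> B j \<in> sets borel"
  shows "cylinder M Z J B \<in> sets (natural_filtration M Z s)"
proof -
  have sp: "space (natural_filtration M Z s) = space M"
    by (simp add: natural_filtration_def space_measure_of_conv)
  have "cylinder M Z J B = (\<Inter>j\<in>J. Z j -` B j \<inter> space (natural_filtration M Z s))"
    using assms(2) by (auto simp: cylinder_def sp)
  also have "\<dots> \<in> sets (natural_filtration M Z s)"
    using assms by (intro sets.finite_INT measurable_sets[OF measurable_natural_filtration]) auto
  finally show ?thesis .
qed

text \<open>The last time \<open>t\<close> is integrated out with the kernel from \<open>s = Max J\<close>.  What remains depends on the past only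
  through the finite measure \<open>\<mu>(C) = M (past event, Z s \<in> C)\<close>, and \<open>\<mu>(C)\<close> is again the probability of
  a cylinder over \<open>J\<close>, the set at time \<open>s\<close> being cut down to \<open>C\<close>.\<close>

lemma cylinder_step:
  assumes Z: "markov_process M Z x0 E P" and J: "finite J" "J \<noteq> {}" "J \<subseteq> {0..}" "\<forall>j\<in>J. j < t"
    and B: "\<forall>j\<in>insert t J. B j \<in> sets borel"
    and P: "(\<lambda>x. measure (P (Max J) t x) (B t)) \<in> borel_measurable borel"
  defines "s \<equiv> Max J"
  defines "\<mu> \<equiv> distr (density M (indicator (cylinder M Z J B))) borel (Z s)"
  shows "measure M (cylinder M Z (insert t J) B) = (LINT x|\<mu>. measure (P s t x) (B t))"
    and "C \<in> sets borel \<Longrightarrow> emeasure \<mu> C = emeasure M (cylinder M Z J (B(s := B s \<inter> C)))"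
proof -
  interpret prob_space M using Z by (simp add: markov_process_def)
  have s: "s \<in> J" unfolding s_def using J(1,2) by (rule Max_in)
  then have s: "s \<in> J" "0 \<le> s" "s < t" using J(3,4) by auto
  have le: "0 \<le> j \<and> j \<le> s" if "j \<in> J" for j
    using that J(3) Max_ge[OF J(1) that] unfolding s_def by auto
  have meas: "Z r \<in> borel_measurable M" if "r \<ge> 0" for r
    using Z that by (simp add: markov_process_def)
  note [measurable] = meas[OF s(2)] P[folded s_def]
  have sub: "subalgebra M (natural_filtration M Z s)"
    by (rule natural_filtration_subalgebra) (use meas in auto)
  let ?A = "cylinder M Z J B"
  have A: "?A \<in> sets (natural_filtration M Z s)"
    using J B le by (intro cylinder_in_natural_filtration) auto
  then have A'[measurable]: "?A \<in> sets M" using sub by (auto simp: subalgebra_def)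
  have "cylinder M Z (insert t J) B = ?A \<inter> (Z t -` B t \<inter> space M)"
    by (auto simp: cylinder_def)
  then have "measure M (cylinder M Z (insert t J) B) = (LINT \<omega>|M. indicator ?A \<omega> * measure (P s t (Z s \<omega>)) (B t))"
    using markov_process_transition[OF Z s(2,3) A, of "B t" "\<lambda>\<omega>. measure (P s t (Z s \<omega>)) (B t)"] B by simp
  also have "\<dots> = (LINT \<omega>|density M (\<lambda>\<omega>. ennreal (indicat_real ?A \<omega>)). measure (P s t (Z s \<omega>)) (B t))"
    by (subst integral_density) (auto simp: indicator_def)
  also have "\<dots> = (LINT x|\<mu>. measure (P s t x) (B t))"
    unfolding \<mu>_def ennreal_indicator by (subst integral_distr) auto
  finally show "measure M (cylinder M Z (insert t J) B) = (LINT x|\<mu>. measure (P s t x) (B t))" .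
  assume C[measurable]: "C \<in> sets borel"
  have "emeasure \<mu> C = emeasure (density M (indicator ?A)) (Z s -` C \<inter> space M)"
    unfolding \<mu>_def by (subst emeasure_distr) auto
  also have "\<dots> = (\<integral>\<^sup>+\<omega>. indicator ?A \<omega> * indicator (Z s -` C \<inter> space M) \<omega> \<partial>M)"
    by (subst emeasure_density) auto
  also have "\<dots> = (\<integral>\<^sup>+\<omega>. indicator (?A \<inter> (Z s -` C \<inter> space M)) \<omega> \<partial>M)"
    by (intro nn_integral_cong) (simp add: indicator_def)
  also have "\<dots> = emeasure M (?A \<inter> (Z s -` C \<inter> space M))"
    by (intro nn_integral_indicator) measurable
  also have "?A \<inter> (Z s -` C \<inter> space M) = cylinder M Z J (B(s := B s \<inter> C))"
    using s(1) by (auto simp: cylinder_def split: if_splits)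
  finally show "emeasure \<mu> C = emeasure M (cylinder M Z J (B(s := B s \<inter> C)))" .
qed

text \<open>Induction on the largest time.  The induction hypothesis, for all choices of sets,
  identifies the measures \<open>\<mu>\<close> of \<open>cylinder_step\<close> for the two processes.\<close>

lemma markov_process_cylinder_eq:
  assumes Z: "markov_process M Z x0 E P" and Y: "markov_process N Y x0 E' P"
    and P: "\<And>s t B. 0 \<le> s \<Longrightarrow> s < t \<Longrightarrow> B \<in> sets borel \<Longrightarrow> (\<lambda>x. measure (P s t x) B) \<in> borel_measurable borel"
    and J: "finite J" "J \<subseteq> {0..}" and B: "\<And>j. j \<in> J \<Longrightarrow> B j \<in> sets borel"
  shows "measure M (cylinder M Z J B) = measure N (cylinder N Y J B)"
  using J B
proof (induction J arbitrary: B rule: finite_linorder_max_induct)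
  case empty
  interpret M: prob_space M using Z by (simp add: markov_process_def)
  interpret N: prob_space N using Y by (simp add: markov_process_def)
  show ?case by (simp add: cylinder_def M.prob_space N.prob_space)
next
  case (insert t J)
  interpret M: prob_space M using Z by (simp add: markov_process_def)
  interpret N: prob_space N using Y by (simp add: markov_process_def)
  show ?case
  proof (cases "J = {}")
    case True
    have c: "cylinder M Z {t} B = Z t -` B t \<inter> space M" "cylinder N Y {t} B = Y t -` B t \<inter> space N"
      by (auto simp: cylinder_def)
    show ?thesis
    proof (cases "t = 0")
      case t: True
      then show ?thesis unfolding True c using insert.prems
        by (simp add: markov_process_initial[OF Z] markov_process_initial[OF Y])
    next
      case False
      then have "t > 0" using insert.prems by simp
      then show ?thesis unfolding True c using insert.prems
        by (simp add: markov_process_marginal[OF Z] markov_process_marginal[OF Y])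
    qed
  next
    case False
    define s where "s = Max J"
    have s: "s \<in> J" unfolding s_def using insert.hyps(1) False by (rule Max_in)
    then have s: "s \<in> J" "0 \<le> s" "s < t" using insert.hyps(2) insert.prems(1) by auto
    have k: "(\<lambda>x. measure (P (Max J) t x) (B t)) \<in> borel_measurable borel"
      using insert.prems s by (intro P) (auto simp: s_def)
    define \<mu> \<nu> where "\<mu> = distr (density M (indicator (cylinder M Z J B))) borel (Z s)"
      and "\<nu> = distr (density N (indicator (cylinder N Y J B))) borel (Y s)"
    have prems: "finite J" "J \<noteq> {}" "J \<subseteq> {0..}" "\<forall>j\<in>J. j < t"
      "\<forall>j\<in>insert t J. B j \<in> sets borel"
      using insert.hyps insert.prems False by auto
    note stepM = cylinder_step[OF Z prems k, folded s_def, folded \<mu>_def]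
    note stepN = cylinder_step[OF Y prems k, folded s_def, folded \<nu>_def]
    have "\<mu> = \<nu>"
    proof (rule measure_eqI)
      show "sets \<mu> = sets \<nu>" by (simp add: \<mu>_def \<nu>_def)
      fix C assume "C \<in> sets \<mu>"
      then have C: "C \<in> sets borel" by (simp add: \<mu>_def)
      have "measure M (cylinder M Z J (B(s := B s \<inter> C))) = measure N (cylinder N Y J (B(s := B s \<inter> C)))"
        using prems(3,5) C by (intro insert.IH) (auto simp: s(1))
      then show "emeasure \<mu> C = emeasure \<nu> C"
        unfolding stepM(2)[OF C] stepN(2)[OF C] by (simp add: M.emeasure_eq_measure N.emeasure_eq_measure)
    qed
    then show ?thesis unfolding stepM(1) stepN(1) by simp
  qed
qed

lemma markov_process_law_unique:
  assumes Z: "markov_process M Z x0 E P" and Y: "markov_process N Y x0 E' P"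
    and P: "\<And>s t B. 0 \<le> s \<Longrightarrow> s < t \<Longrightarrow> B \<in> sets borel \<Longrightarrow> (\<lambda>x. measure (P s t x) B) \<in> borel_measurable borel"
  shows "process_law M Z = process_law N Y"
proof (rule measure_eqI_PiM_infinite[where I = "{0..}" and M = "\<lambda>_. borel"])
  interpret M: prob_space M using Z by (simp add: markov_process_def)
  interpret N: prob_space N using Y by (simp add: markov_process_def)
  have measM: "(\<lambda>\<omega>. \<lambda>t\<in>{0..}. Z t \<omega>) \<in> measurable M (PiM {0..} (\<lambda>_. borel))"
    using Z by (intro measurable_restrict) (auto simp: markov_process_def)
  have measN: "(\<lambda>\<omega>. \<lambda>t\<in>{0..}. Y t \<omega>) \<in> measurable N (PiM {0..} (\<lambda>_. borel))"
    using Y by (intro measurable_restrict) (auto simp: markov_process_def)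
  show "sets (process_law M Z) = sets (PiM {0..} (\<lambda>_. borel))" 
    "sets (process_law N Y) = sets (PiM {0..} (\<lambda>_. borel))" by (simp_all add: process_law_def)
  show "finite_measure (process_law M Z)"
    unfolding process_law_def by (rule M.finite_measure_distr[OF measM])
  fix A :: "real \<Rightarrow> real set" and J assume J: "finite J" "J \<subseteq> {0..}" "\<And>i. i \<in> J \<Longrightarrow> A i \<in> sets borel"
  let ?X = "prod_emb {0..} (\<lambda>_. borel) J (Pi\<^sub>E J A)"
  have X: "?X \<in> sets (PiM {0..} (\<lambda>_. borel))" using J by (intro sets_PiM_I) auto
  have pre: "(\<lambda>\<omega>. \<lambda>t\<in>{0..}. W t \<omega>) -` ?X \<inter> space K = cylinder K W J A" for K :: "'c measure" and W
    using J(2) by (auto simp: prod_emb_def cylinder_def PiE_iff extensional_def subset_iff)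
  have "emeasure (process_law M Z) ?X = emeasure M (cylinder M Z J A)"
    unfolding process_law_def by (simp only: emeasure_distr[OF measM X] pre)
  also have "\<dots> = emeasure N (cylinder N Y J A)"
    unfolding M.emeasure_eq_measure N.emeasure_eq_measure
    by (rule arg_cong[where f = ennreal], rule markov_process_cylinder_eq[OF Z Y P J])
  also have "\<dots> = emeasure (process_law N Y) ?X"
    unfolding process_law_def by (simp only: emeasure_distr[OF measN X] pre)
  finally show "emeasure (process_law M Z) ?X = emeasure (process_law N Y) ?X" .
qed

section \<open>The Biane process of the semigroup\<close>

lemma measure_P_half_support:
  assumes t: "t > 0"
  shows "measure (P_half 0 t 0) {t\<^sup>2 / 4<..} = 1"
proof -
  have eq: "nu_half t = P_half 0 t 0" using t by (rule nu_half_eq_P_half)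
  interpret prob_space "P_half 0 t 0"
    using real_prob_nu_half[of t] t unfolding eq real_prob_def by simp
  have "AE x in P_half 0 t 0. x \<in> {t\<^sup>2 / 4<..}"
    unfolding P_half_def by (subst AE_density) (auto simp: f_half_def indicator_def)
  then show ?thesis by (subst prob_eq_1) (auto simp: P_half_def)
qed

text \<open>At every time both kinds of process live almost surely in \<open>states_half\<close>, where the Biane kernel
  and \<open>P_half\<close> coincide.  For a Biane process this follows from its one-dimensional laws.\<close>

lemma biane_process_nu_half_iff: "biane_process nu_half M Z \<longleftrightarrow> Z_half_process M Z"
proof
  assume "biane_process nu_half M Z"
  then obtain Q where Q: "\<And>s t. 0 \<le> s \<Longrightarrow> s < t \<Longrightarrow> biane_kernel nu_half s t (Q s t)"
    and Z: "markov_process M Z 0 (\<lambda>_. UNIV) Q" by (auto simp: biane_process_def)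
  interpret prob_space M using Z by (simp add: markov_process_def)
  have states: "AE \<omega> in M. Z t \<omega> \<in> states_half t" if t: "t \<ge> 0" for t
  proof (cases "t = 0")
    case True
    then show ?thesis using Z by (auto simp: markov_process_def states_half_def)
  next
    case False
    with t have t0: "t > 0" by simp
    have "Q 0 t 0 = P_half 0 t 0"
      using t0 by (intro biane_kernel_nu_half_eq_P_half Q) (auto simp: states_half_def)
    then have "prob (Z t -` {t\<^sup>2 / 4<..} \<inter> space M) = 1"
      using markov_process_marginal[OF Z t0, of "{t\<^sup>2 / 4<..}"] measure_P_half_support[OF t0] by simp
    then have "AE \<omega> in M. \<omega> \<in> Z t -` {t\<^sup>2 / 4<..} \<inter> space M" by (rule AE_prob_1)
    then show ?thesis by eventually_elim (simp add: states_half_def)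
  qed
  show "Z_half_process M Z"
    unfolding Z_half_process_def markov_process_def
  proof (intro conjI allI impI ballI)
    fix s t :: real and B :: "real set" assume st: "0 \<le> s" "s < t" and B: "B \<in> sets borel"
    have "AE \<omega> in M. real_cond_exp M (natural_filtration M Z s) (indicator (Z t -` B \<inter> space M)) \<omega> = measure (Q s t (Z s \<omega>)) B"
      using Z st B by (auto simp: markov_process_def)
    then show "AE \<omega> in M. real_cond_exp M (natural_filtration M Z s) (indicator (Z t -` B \<inter> space M)) \<omega> = measure (P_half s t (Z s \<omega>)) B"
      using states[OF st(1)]
      by eventually_elim (simp add: biane_kernel_nu_half_eq_P_half[OF st Q[OF st]])
  qed (use Z states in \<open>auto simp: markov_process_def\<close>)
next
  assume Z: "Z_half_process M Z"
  obtain Q where Q: "\<And>s t. 0 \<le> s \<Longrightarrow> s < t \<Longrightarrow> biane_kernel nu_half s t (Q s t)"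
    using biane_kernel_nu_half_unique by metis
  have "markov_process M Z 0 (\<lambda>_. UNIV) Q"
    unfolding markov_process_def
  proof (intro conjI allI impI ballI)
    fix s t :: real and B :: "real set" assume st: "0 \<le> s" "s < t" and B: "B \<in> sets borel"
    have "AE \<omega> in M. real_cond_exp M (natural_filtration M Z s) (indicator (Z t -` B \<inter> space M)) \<omega> = measure (P_half s t (Z s \<omega>)) B"
      "AE \<omega> in M. Z s \<omega> \<in> states_half s"
      using Z st B by (auto simp: Z_half_process_def markov_process_def)
    then show "AE \<omega> in M. real_cond_exp M (natural_filtration M Z s) (indicator (Z t -` B \<inter> space M)) \<omega> = measure (Q s t (Z s \<omega>)) B"
      by eventually_elim (simp add: biane_kernel_nu_half_eq_P_half[OF st Q[OF st]])
  qed (use Z in \<open>auto simp: Z_half_process_def markov_process_def\<close>)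
  then show "biane_process nu_half M Z"
    unfolding biane_process_def using free_convolution_semigroup_nu_half Q by blast
qed

theorem proposition3p1:
  fixes M :: "'a measure" and Z :: "real \<Rightarrow> 'a \<Rightarrow> real"
    and N :: "'b measure" and Y :: "real \<Rightarrow> 'b \<Rightarrow> real"
  shows "free_convolution_semigroup nu_half \<and>
    (\<forall>s\<ge>0. \<forall>t>s. (\<exists>!Q. biane_kernel nu_half s t Q) \<and>
       (\<forall>Q. biane_kernel nu_half s t Q \<longrightarrow> (\<forall>y\<in>states_half s. Q y = P_half s t y))) \<and>
    (biane_process nu_half M Z \<longleftrightarrow> Z_half_process M Z) \<and>
    (biane_process nu_half M Z \<and> Z_half_process N Y \<longrightarrow> process_law M Z = process_law N Y)"
proof (rule conjI[OF free_convolution_semigroup_nu_half], rule conjI[OF _ conjI[OF biane_process_nu_half_iff]])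
  show "\<forall>s\<ge>0. \<forall>t>s. (\<exists>!Q. biane_kernel nu_half s t Q) \<and>
      (\<forall>Q. biane_kernel nu_half s t Q \<longrightarrow> (\<forall>y\<in>states_half s. Q y = P_half s t y))"
  proof (rule allI, rule impI, rule allI, rule impI, rule conjI)
    fix s t :: real assume st: "0 \<le> s" "s < t"
    show "\<exists>!Q. biane_kernel nu_half s t Q" by (rule biane_kernel_nu_half_unique[OF st])
    show "\<forall>Q. biane_kernel nu_half s t Q \<longrightarrow> (\<forall>y\<in>states_half s. Q y = P_half s t y)"
      using biane_kernel_nu_half_eq_P_half[OF st] by simp
  qed
  show "biane_process nu_half M Z \<and> Z_half_process N Y \<longrightarrow> process_law M Z = process_law N Y"
  proof
    assume "biane_process nu_half M Z \<and> Z_half_process N Y"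
    then have "markov_process M Z 0 states_half P_half" "markov_process N Y 0 states_half P_half"
      unfolding biane_process_nu_half_iff Z_half_process_def by simp_all
    then show "process_law M Z = process_law N Y"
      by (rule markov_process_law_unique[OF _ _ measurable_P_half])
  qed
qed

end
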